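(* $\Delta_0(\ker\Delta_2)=\Delta_0(\ker\Delta_1)=\ell_f$.
   Context: All spaces are complex. For the couple $(X_0,X_1)=(\ell_\infty,\ell_1)$ put $\Sigma=\ell_\infty+\ell_1$. The Calderón space $\mathcal C$ of the couple is the Banach space of bounded continuous functions $F:\{z\in\mathbb C:0\le \mathrm{Re}\,z\le 1\}\to\Sigma$, analytic on the open strip, such that for $j=0,1$ the map $t\mapsto F(j+it)$ is continuous from $\mathbb R$ into $X_j$ and tends to $0$ as $|t|\to\infty$, with norm $\|F\|=\max_{j=0,1}\sup_{t}\|F(j+it)\|_{X_j}$. For $k=0,1,2$ let $\Delta_k:\mathcal C\to\Sigma$, $\Delta_k(F)=F^{(k)}(1/2)/k!$. $\ell_f$ is the Orlicz sequence space of the Orlicz function which near $0$ is $f(t)=t^2\log^2t$; that is, $\ell_f=\{x\in\ell_2:x\log|x|\in\ell_2\}$. The space $T(K)$ carries the quotient norm $\|x\|=\inf\{\|F\|:F\in K,\ TF=x\}$, and equality means equality of sets of sequences with equivalence of norms. *)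

theory Defs
  imports "HOL-Analysis.Analysis"
begin

text \<open>A normed space of complex sequences is given by its set of points and its norm; the value of
  the norm function outside the set of points carries no meaning.\<close>

record seq_space =
  points :: "(nat \<Rightarrow> complex) set"
  nrm :: "(nat \<Rightarrow> complex) \<Rightarrow> real"

definition linf :: seq_space where
  "linf = \<lparr>points = {x. bounded (range x)}, nrm = (\<lambda>x. SUP n. cmod (x n))\<rparr>"

definition l1 :: seq_space where
  "l1 = \<lparr>points = {x. summable (\<lambda>n. cmod (x n))}, nrm = (\<lambda>x. \<Sum>n. cmod (x n))\<rparr>"

definition l2 :: seq_space where
  "l2 = \<lparr>points = {x. summable (\<lambda>n. (cmod (x n))\<^sup>2)}, nrm = (\<lambda>x. sqrt (\<Sum>n. (cmod (x n))\<^sup>2))\<rparr>"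

definition sum_space :: "seq_space \<Rightarrow> seq_space \<Rightarrow> seq_space" where
  "sum_space X Y =
     \<lparr>points = {(\<lambda>n. a n + b n) | a b. a \<in> points X \<and> b \<in> points Y},
      nrm = (\<lambda>x. Inf {nrm X a + nrm Y b | a b.
                        a \<in> points X \<and> b \<in> points Y \<and> x = (\<lambda>n. a n + b n)})\<rparr>"

definition tends_in :: "seq_space \<Rightarrow> ('a \<Rightarrow> nat \<Rightarrow> complex) \<Rightarrow> (nat \<Rightarrow> complex) \<Rightarrow> 'a filter \<Rightarrow> bool" where
  "tends_in X g l A \<longleftrightarrow>
     l \<in> points X \<and> (\<forall>\<^sub>F s in A. g s \<in> points X) \<and>
     ((\<lambda>s. nrm X (\<lambda>n. g s n - l n)) \<longlongrightarrow> 0) A"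

definition continuous_in ::
    "seq_space \<Rightarrow> 'a::topological_space set \<Rightarrow> ('a \<Rightarrow> nat \<Rightarrow> complex) \<Rightarrow> bool" where
  "continuous_in X S g \<longleftrightarrow> (\<forall>s\<in>S. tends_in X g (g s) (at s within S))"

definition has_cderiv ::
    "seq_space \<Rightarrow> (complex \<Rightarrow> nat \<Rightarrow> complex) \<Rightarrow> (nat \<Rightarrow> complex) \<Rightarrow> complex \<Rightarrow> bool" where
  "has_cderiv X F D z \<longleftrightarrow> tends_in X (\<lambda>w n. (F w n - F z n) / (w - z)) D (at z)"

definition cderiv ::
    "seq_space \<Rightarrow> (complex \<Rightarrow> nat \<Rightarrow> complex) \<Rightarrow> complex \<Rightarrow> nat \<Rightarrow> complex" where
  "cderiv X F z = (THE D. has_cderiv X F D z)"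

definition strip :: "complex set" where
  "strip = {z. 0 \<le> Re z \<and> Re z \<le> 1}"

definition open_strip :: "complex set" where
  "open_strip = {z. 0 < Re z \<and> Re z < 1}"

text \<open>The Calderon space of a couple.  A function on the closed strip is represented by its
  extension by zero, so that distinct representatives are distinct functions on the strip.\<close>

definition calderon :: "seq_space \<Rightarrow> seq_space \<Rightarrow> (complex \<Rightarrow> nat \<Rightarrow> complex) set" where
  "calderon X0 X1 =
     {F. (\<forall>z. z \<notin> strip \<longrightarrow> F z = (\<lambda>n. 0)) \<and>
         (\<forall>z\<in>strip. F z \<in> points (sum_space X0 X1)) \<and>
         bounded ((\<lambda>z. nrm (sum_space X0 X1) (F z)) ` strip) \<and>
         continuous_in (sum_space X0 X1) strip F \<and>
         (\<forall>z\<in>open_strip. \<exists>D. has_cderiv (sum_space X0 X1) F D z) \<and>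
         continuous_in X0 UNIV (\<lambda>t::real. F (Complex 0 t)) \<and>
         continuous_in X1 UNIV (\<lambda>t::real. F (Complex 1 t)) \<and>
         tends_in X0 (\<lambda>t::real. F (Complex 0 t)) (\<lambda>n. 0) at_infinity \<and>
         tends_in X1 (\<lambda>t::real. F (Complex 1 t)) (\<lambda>n. 0) at_infinity}"

definition calderon_norm ::
    "seq_space \<Rightarrow> seq_space \<Rightarrow> (complex \<Rightarrow> nat \<Rightarrow> complex) \<Rightarrow> real" where
  "calderon_norm X0 X1 F =
     max (SUP t::real. nrm X0 (F (Complex 0 t))) (SUP t::real. nrm X1 (F (Complex 1 t)))"

definition Delta ::
    "seq_space \<Rightarrow> seq_space \<Rightarrow> nat \<Rightarrow> (complex \<Rightarrow> nat \<Rightarrow> complex) \<Rightarrow> nat \<Rightarrow> complex" where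
  "Delta X0 X1 k F = (\<lambda>n. ((cderiv (sum_space X0 X1) ^^ k) F) (1/2) n / fact k)"

definition ker_Delta ::
    "seq_space \<Rightarrow> seq_space \<Rightarrow> nat \<Rightarrow> (complex \<Rightarrow> nat \<Rightarrow> complex) set" where
  "ker_Delta X0 X1 k = {F \<in> calderon X0 X1. Delta X0 X1 k F = (\<lambda>n. 0)}"

definition image_space ::
    "((complex \<Rightarrow> nat \<Rightarrow> complex) \<Rightarrow> nat \<Rightarrow> complex) \<Rightarrow> (complex \<Rightarrow> nat \<Rightarrow> complex) set \<Rightarrow>
     ((complex \<Rightarrow> nat \<Rightarrow> complex) \<Rightarrow> real) \<Rightarrow> seq_space" where
  "image_space T K N = \<lparr>points = T ` K, nrm = (\<lambda>x. Inf {N F | F. F \<in> K \<and> T F = x})\<rparr>"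

definition orlicz_function :: "(real \<Rightarrow> real) \<Rightarrow> bool" where
  "orlicz_function f \<longleftrightarrow>
     f 0 = 0 \<and> continuous_on {0..} f \<and> mono_on {0..} f \<and> convex_on {0..} f \<and>
     filterlim f at_top at_top"

text \<open>The norm is the Luxemburg norm.\<close>

definition orlicz_space :: "(real \<Rightarrow> real) \<Rightarrow> seq_space" where
  "orlicz_space f =
     \<lparr>points = {x. \<exists>r>0. summable (\<lambda>n. f (cmod (x n) / r))},
      nrm = (\<lambda>x. Inf {r. r > 0 \<and> summable (\<lambda>n. f (cmod (x n) / r)) \<and>
                         (\<Sum>n. f (cmod (x n) / r)) \<le> 1})\<rparr>"

definition equal_spaces :: "seq_space \<Rightarrow> seq_space \<Rightarrow> bool" where
  "equal_spaces X Y \<longleftrightarrow>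
     points X = points Y \<and>
     (\<exists>c>0. \<exists>C>0. \<forall>x\<in>points X. c * nrm Y x \<le> nrm X x \<and> nrm X x \<le> C * nrm Y x)"

text \<open>Whatever the behaviour of the Orlicz function away from zero, the Orlicz space is the set of
  those \<open>x\<close> in \<open>l2\<close> for which \<open>x log |x|\<close> lies in \<open>l2\<close>.\<close>

lemma points_orlicz_space:
  assumes f: "orlicz_function f"
    and near: "\<forall>\<^sub>F t in at_right 0. f t = t\<^sup>2 * (ln t)\<^sup>2"
  shows "points (orlicz_space f) =
    {x \<in> points l2. (\<lambda>n. x n * complex_of_real (ln (cmod (x n)))) \<in> points l2}"
proof -
  obtain d0 where d0: "d0 > 0" "\<And>t. 0 < t \<Longrightarrow> t < d0 \<Longrightarrow> f t = t\<^sup>2 * (ln t)\<^sup>2"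
    using near unfolding eventually_at_right_field by auto
  have f0: "f 0 = 0" and mon: "mono_on {0..} f" using f by (auto simp: orlicz_function_def)
  define d where "d = min d0 (exp (-1))"
  have d: "d > 0" "d \<le> exp (-1)" "d < 1" using d0(1) by (auto simp: d_def min_less_iff_disj)
  have fd: "f t = t\<^sup>2 * (ln t)\<^sup>2" if "0 \<le> t" "t < d" for t
    using d0(2)[of t] that f0 by (cases "t = 0") (auto simp: d_def)
  have lnbig: "1 \<le> (ln t)\<^sup>2" if "0 < t" "t < d" for t :: real
  proof -
    have "ln t \<le> -1" using that d(2) ln_le_cancel_iff[of t "exp (-1)"] by simp
    then show ?thesis using power_mono[of 1 "- ln t" 2] by simp
  qed
  show ?thesis
  proof (intro set_eqI iffI)
    fix x assume "x \<in> points (orlicz_space f)"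
    then obtain r where r: "r > 0" and s: "summable (\<lambda>n. f (cmod (x n) / r))"
      by (auto simp: orlicz_space_def)
    define y where "y n = cmod (x n) / r" for n
    have y0: "0 \<le> y n" for n using r by (simp add: y_def)
    have xy: "cmod (x n) = r * y n" for n using r by (simp add: y_def)
    have "f (d/2) > 0" using fd[of "d/2"] d lnbig[of "d/2"] by simp
    moreover have "(\<lambda>n. f (y n)) \<longlonglongrightarrow> 0"
      using summable_LIMSEQ_zero[OF s] by (simp add: y_def)
    ultimately have "\<forall>\<^sub>F n in sequentially. f (y n) < f (d/2)"
      by (rule order_tendstoD(2)[rotated])
    then have ev: "\<forall>\<^sub>F n in sequentially. y n < d"
    proof eventually_elim
      case (elim n)
      show ?case
      proof (rule ccontr)
        assume "\<not> y n < d"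
        then have "f (d/2) \<le> f (y n)" using d y0[of n] by (intro mono_onD[OF mon]) auto
        with elim show False by simp
      qed
    qed
    have s': "summable (\<lambda>n. f (y n))" using s by (simp add: y_def)
    have sy: "summable (\<lambda>n. (y n)\<^sup>2 * (ln (y n))\<^sup>2)"
      using s' by (rule summable_cong[THEN iffD1, rotated])
         (use ev in eventually_elim, use fd y0 in auto)
    have "\<forall>\<^sub>F n in sequentially. norm ((y n)\<^sup>2) \<le> (y n)\<^sup>2 * (ln (y n))\<^sup>2"
      using ev
    proof eventually_elim
      case (elim n)
      then show ?case using y0[of n] lnbig[of "y n"]
          mult_left_mono[of 1 "(ln (y n))\<^sup>2" "(y n)\<^sup>2"] by (cases "y n = 0") auto
    qed
    then have sy2: "summable (\<lambda>n. (y n)\<^sup>2)" using sy by (rule summable_comparison_test_ev)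
    have x2: "x \<in> points l2"
      using summable_mult[OF sy2, of "r\<^sup>2"] by (simp add: l2_def xy power_mult_distrib)
    have "summable (\<lambda>n. 2 * r\<^sup>2 * ((y n)\<^sup>2 * (ln (y n))\<^sup>2) + 2 * r\<^sup>2 * (ln r)\<^sup>2 * (y n)\<^sup>2)"
      by (intro summable_add summable_mult sy sy2)
    moreover have "norm ((cmod (x n * complex_of_real (ln (cmod (x n)))))\<^sup>2)
       \<le> 2 * r\<^sup>2 * ((y n)\<^sup>2 * (ln (y n))\<^sup>2) + 2 * r\<^sup>2 * (ln r)\<^sup>2 * (y n)\<^sup>2" for n
    proof (cases "y n = 0")
      case True then show ?thesis using xy[of n] by simp
    next
      case False
      then have "ln (cmod (x n)) = ln r + ln (y n)"
        using r y0[of n] by (simp add: xy ln_mult)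
      then have "(cmod (x n * complex_of_real (ln (cmod (x n)))))\<^sup>2 = r\<^sup>2 * (y n)\<^sup>2 * (ln r + ln (y n))\<^sup>2"
        by (simp only: norm_mult norm_of_real power_mult_distrib power2_abs) (simp add: xy power_mult_distrib)
      also have "\<dots> \<le> r\<^sup>2 * (y n)\<^sup>2 * (2 * (ln r)\<^sup>2 + 2 * (ln (y n))\<^sup>2)"
        using sum_squares_bound[of "ln r" "ln (y n)"]
        by (intro mult_left_mono) (auto simp: power2_sum)
      finally show ?thesis by (simp add: algebra_simps)
    qed
    ultimately have "summable (\<lambda>n. (cmod (x n * complex_of_real (ln (cmod (x n)))))\<^sup>2)"
      by (rule summable_comparison_test'[where N = 0])
    with x2 show "x \<in> {x \<in> points l2. (\<lambda>n. x n * complex_of_real (ln (cmod (x n)))) \<in> points l2}"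
      by (simp add: l2_def)
  next
    fix x assume "x \<in> {x \<in> points l2. (\<lambda>n. x n * complex_of_real (ln (cmod (x n)))) \<in> points l2}"
    then have s: "summable (\<lambda>n. (cmod (x n))\<^sup>2)"
      and sl: "summable (\<lambda>n. (cmod (x n))\<^sup>2 * (ln (cmod (x n)))\<^sup>2)"
      by (auto simp: l2_def norm_mult power_mult_distrib)
    have "\<forall>\<^sub>F n in sequentially. (cmod (x n))\<^sup>2 < d\<^sup>2"
      using d by (intro order_tendstoD(2)[OF summable_LIMSEQ_zero[OF s]]) simp
    then have e: "\<forall>\<^sub>F n in sequentially. (cmod (x n))\<^sup>2 * (ln (cmod (x n)))\<^sup>2 = f (cmod (x n) / 1)"
    proof eventually_elim
      case (elim n)
      then have "cmod (x n) < d" using d by (auto intro: power2_less_imp_less)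
      then show ?case using fd by simp
    qed
    have "summable (\<lambda>n. f (cmod (x n) / 1))" by (rule iffD1[OF summable_cong[OF e] sl])
    then show "x \<in> points (orlicz_space f)"
      unfolding orlicz_space_def by (auto intro: exI[of _ 1])
  qed
qed

end

theory Submission
  imports Defs "HOL-Complex_Analysis.Complex_Analysis"
begin

text \<open>
  Up to a factor that decays at infinity, everything is built coordinatewise from
  \<open>k(w) = (p + q w) exp(-2 s w)\<close>, \<open>w = z - 1/2\<close>, for which
  \<open>k(0) = p\<close>, \<open>k'(0) = q - 2 s p\<close> and \<open>k''(0) = 4 s (s p - q)\<close>: the number \<open>q\<close> can be chosen to make the first or the second derivative vanish.

  If \<open>x\<close> is small and \<open>L = - ln |x|\<close>, \<open>M = |x| L\<close>, \<open>\<Lambda> = - ln M\<close>, then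
  \<open>F\<^sub>n = sgn x\<^sub>n M\<^sub>n k\<close> with \<open>p = 1/L\<close>, \<open>s = \<Lambda>\<close> and \<open>q = 2\<Lambda>/L\<close> or \<open>q = \<Lambda>/L\<close> takes the value \<open>x\<close> at
  \<open>1/2\<close>, is bounded on the line \<open>Re z = 0\<close> and of size \<open>M\<^sup>2 = |x|\<^sup>2 ln\<^sup>2 |x|\<close> on the line \<open>Re z = 1\<close>.

  Conversely, pair \<open>F\<close> with finitely many test functions \<open>b\<^sub>n = \<beta>\<^sub>n k\<close>, \<open>s = ln \<beta>\<^sub>n\<close>, where
  \<open>\<Sum>\<beta>\<^sub>n\<^sup>2 \<le> 1\<close>, with \<open>p = 1, q = 0\<close> if \<open>F'(1/2) = 0\<close> and with
  \<open>p = - 1/s, q = - 2\<close>, so that \<open>b\<^sub>n'(1/2) = 0\<close>, if \<open>F''(1/2) = 0\<close>.  The first or second derivative of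
  \<open>\<Sum>F\<^sub>n b\<^sub>n\<close> at \<open>1/2\<close> only involves \<open>F(1/2)\<close>, and by the maximum principle it is bounded.  This gives
  \<open>\<Sum>|x\<^sub>n| \<beta>\<^sub>n |ln \<beta>\<^sub>n| \<le> C \<parallel>F\<parallel>\<close>, and \<open>\<beta>\<close> proportional to \<open>|x| |ln |x||\<close> bounds the sum of
  \<open>|x|\<^sup>2 ln\<^sup>2 |x|\<close>.
\<close>

subsection \<open>The norms of the couple\<close>

lemma points_linf: "points linf = {x. bounded (range x)}"
  and points_l1: "points l1 = {x. summable (\<lambda>n. cmod (x n))}"
  and nrm_l1: "nrm l1 x = (\<Sum>n. cmod (x n))"
  by (auto simp: linf_def l1_def)

lemma points_linfI: "(\<And>n. cmod (x n) \<le> K) \<Longrightarrow> x \<in> points linf"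
  by (auto simp: points_linf bounded_iff)

lemma norm_le_nrm_linf: "x \<in> points linf \<Longrightarrow> cmod (x n) \<le> nrm linf x"
  by (auto simp: linf_def bounded_iff intro!: cSUP_upper bdd_aboveI2)

lemma nrm_linf_le: "(\<And>n. cmod (x n) \<le> K) \<Longrightarrow> nrm linf x \<le> K"
  by (auto simp: linf_def intro!: cSUP_least)

lemma norm_le_nrm_l1: "x \<in> points l1 \<Longrightarrow> cmod (x n) \<le> nrm l1 x"
  using sum_le_suminf[of "\<lambda>n. cmod (x n)" "{n}"] by (simp add: points_l1 nrm_l1)

lemma l1_subset_linf: "x \<in> points l1 \<Longrightarrow> x \<in> points linf"
  using norm_le_nrm_l1 by (rule points_linfI)

lemma points_sum_space: "points (sum_space linf l1) = points linf"
proof (intro equalityI subsetI)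
  fix x assume "x \<in> points (sum_space linf l1)"
  then obtain a b where "a \<in> points linf" "b \<in> points l1" "x = (\<lambda>n. a n + b n)"
    by (auto simp: sum_space_def)
  then show "x \<in> points linf"
    using bounded_plus_comp[of a UNIV b] l1_subset_linf[of b] by (auto simp: points_linf)
next
  fix x assume "x \<in> points linf"
  moreover have "(\<lambda>n. 0) \<in> points l1" by (simp add: points_l1)
  moreover have "x = (\<lambda>n. x n + 0)" by simp
  ultimately show "x \<in> points (sum_space linf l1)"
    using \<open>x \<in> points linf\<close>
    by (simp add: sum_space_def) (intro exI[of _ x] exI[of _ "\<lambda>n. 0"], simp)
qed

text \<open>The embedding of l1 into linf has norm at most 1, so no splitting beats
  \<open>x + 0\<close>. Thus the sum space is linf with the same norm, and convergence in it is
  uniform convergence of the coordinates.\<close>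

lemma nrm_sum_space:
  assumes "x \<in> points linf"
  shows "nrm (sum_space linf l1) x = nrm linf x"
proof -
  have "Inf {nrm linf a + nrm l1 b | a b. a \<in> points linf \<and> b \<in> points l1 \<and> x = (\<lambda>n. a n + b n)}
     = nrm linf x"
  proof (rule cInf_eq_minimum)
    have "nrm linf x = nrm linf x + nrm l1 (\<lambda>n. 0) \<and> x = (\<lambda>n. x n + 0) \<and> (\<lambda>n. 0) \<in> points l1"
      by (auto simp: points_l1 nrm_l1)
    with assms show "nrm linf x
        \<in> {nrm linf a + nrm l1 b | a b. a \<in> points linf \<and> b \<in> points l1 \<and> x = (\<lambda>n. a n + b n)}"
      by blast
  next
    fix y
    assume "y \<in> {nrm linf a + nrm l1 b | a b.
                   a \<in> points linf \<and> b \<in> points l1 \<and> x = (\<lambda>n. a n + b n)}"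
    then obtain a b where y: "y = nrm linf a + nrm l1 b"
      and a: "a \<in> points linf" and b: "b \<in> points l1" and x: "x = (\<lambda>n. a n + b n)"
      by auto
    show "nrm linf x \<le> y"
      unfolding x y
      by (intro nrm_linf_le norm_triangle_le add_mono norm_le_nrm_linf norm_le_nrm_l1 a b)
  qed
  then show ?thesis by (simp add: sum_space_def)
qed

lemma tends_in_linf: "tends_in linf g l A \<longleftrightarrow> bounded (range l) \<and> uniform_limit UNIV g l A"
proof
  assume L: "tends_in linf g l A"
  then have l: "bounded (range l)" and ev: "\<forall>\<^sub>F s in A. g s \<in> points linf"
    and lim: "((\<lambda>s. nrm linf (\<lambda>n. g s n - l n)) \<longlongrightarrow> 0) A"
    by (auto simp: tends_in_def points_linf)
  have "\<forall>\<^sub>F s in A. \<forall>n\<in>UNIV. dist (g s n) (l n) < e" if "e > 0" for e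
    using order_tendstoD(2)[OF lim that] ev
  proof eventually_elim
    case (elim s)
    then have "(\<lambda>n. g s n - l n) \<in> points linf"
      using l bounded_minus_comp[of "g s" UNIV l] by (auto simp: points_linf)
    from norm_le_nrm_linf[OF this] elim show ?case by (auto simp: dist_norm intro: le_less_trans)
  qed
  with l show "bounded (range l) \<and> uniform_limit UNIV g l A" by (auto intro: uniform_limitI)
next
  assume R: "bounded (range l) \<and> uniform_limit UNIV g l A"
  then obtain K where K: "\<And>n. cmod (l n) \<le> K" by (auto simp: bounded_iff)
  have close: "\<forall>\<^sub>F s in A. \<forall>n. cmod (g s n - l n) < e" if "e > 0" for e
    using uniform_limitD[OF conjunct2[OF R] that] by (simp add: dist_norm)
  have "\<forall>\<^sub>F s in A. g s \<in> points linf"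
    using close[of 1, simplified]
  proof eventually_elim
    case (elim s)
    have "cmod (g s n) \<le> K + 1" for n
      using norm_triangle_ineq[of "g s n - l n" "l n"] K[of n] elim[rule_format, of n] by simp
    then show ?case by (rule points_linfI)
  qed
  moreover have "((\<lambda>s. nrm linf (\<lambda>n. g s n - l n)) \<longlongrightarrow> 0) A"
  proof (rule tendstoI)
    fix e :: real assume e: "e > 0"
    \<comment> \<open>A supremum of terms below a bound may equal that bound; halving
      \<open>e\<close> restores the strict inequality.\<close>
    then have "e / 2 > 0" by simp
    from close[OF this] show "\<forall>\<^sub>F s in A. dist (nrm linf (\<lambda>n. g s n - l n)) 0 < e"
    proof eventually_elim
      case (elim s)
      then have le: "cmod (g s n - l n) \<le> e / 2" for n by (simp add: less_imp_le)
      have "0 \<le> nrm linf (\<lambda>n. g s n - l n)"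
        by (rule order_trans[OF norm_ge_zero norm_le_nrm_linf[OF points_linfI[OF le]]])
      moreover have "nrm linf (\<lambda>n. g s n - l n) \<le> e / 2" using le by (rule nrm_linf_le)
      ultimately show ?case using e by simp
    qed
  qed
  ultimately show "tends_in linf g l A" using R by (simp add: tends_in_def points_linf)
qed

lemma tends_in_sum_space: "tends_in (sum_space linf l1) g l A \<longleftrightarrow> tends_in linf g l A"
\<comment> \<open>The two norms are known to agree only on \<open>points linf\<close>. If one of the
  membership conditions fails, both sides are false.\<close>
proof (cases "l \<in> points linf \<and> (\<forall>\<^sub>F s in A. g s \<in> points linf)")
  case True
  then have "\<forall>\<^sub>F s in A. nrm (sum_space linf l1) (\<lambda>n. g s n - l n) = nrm linf (\<lambda>n. g s n - l n)"
    by (auto elim!: eventually_mono intro!: nrm_sum_space bounded_minus_comp simp: points_linf)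
  from tendsto_cong[OF this] show ?thesis by (simp add: tends_in_def points_sum_space)
qed (auto simp: tends_in_def points_sum_space)

lemma tends_in_linf_coordinate: "tends_in linf g l A \<Longrightarrow> ((\<lambda>s. g s n) \<longlongrightarrow> l n) A"
  by (auto simp: tends_in_linf intro: tendsto_uniform_limitI)

lemma abs_nrm_l1_diff_le:
  assumes "x \<in> points l1" "y \<in> points l1"
  shows "\<bar>nrm l1 x - nrm l1 y\<bar> \<le> nrm l1 (\<lambda>n. x n - y n)"
proof -
  have sx: "summable (\<lambda>n. cmod (x n))" and sy: "summable (\<lambda>n. cmod (y n))"
    using assms by (auto simp: points_l1)
  have s: "summable (\<lambda>n. cmod (x n - y n))"
    by (rule summable_comparison_test'[OF summable_add[OF sx sy], of 0])
      (simp add: norm_triangle_ineq4)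
  have "\<bar>nrm l1 x - nrm l1 y\<bar> = \<bar>\<Sum>n. cmod (x n) - cmod (y n)\<bar>"
    using suminf_diff[OF sx sy] by (simp add: nrm_l1)
  also have "\<dots> \<le> (\<Sum>n. \<bar>cmod (x n) - cmod (y n)\<bar>)"
    by (rule summable_rabs, rule summable_comparison_test'[OF s, of 0])
      (simp add: norm_triangle_ineq3)
  also have "\<dots> \<le> nrm l1 (\<lambda>n. x n - y n)"
    unfolding nrm_l1
    by (rule suminf_le[OF _ _ s], simp add: norm_triangle_ineq3,
        rule summable_comparison_test'[OF s, of 0]) (simp add: norm_triangle_ineq3)
  finally show ?thesis .
qed

lemma tends_in_l1_nrm:
  assumes "tends_in l1 g l A"
  shows "((\<lambda>s. nrm l1 (g s)) \<longlongrightarrow> nrm l1 l) A"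
proof (rule LIM_zero_cancel, rule Lim_null_comparison)
  show "((\<lambda>s. nrm l1 (\<lambda>n. g s n - l n)) \<longlongrightarrow> 0) A"
    using assms by (simp add: tends_in_def)
  have "\<forall>\<^sub>F s in A. g s \<in> points l1" using assms by (simp add: tends_in_def)
  then show "\<forall>\<^sub>F s in A. norm (nrm l1 (g s) - nrm l1 l) \<le> nrm l1 (\<lambda>n. g s n - l n)"
    using assms by (auto elim!: eventually_mono intro!: abs_nrm_l1_diff_le simp: tends_in_def)
qed

subsection \<open>Derivatives of sequence-valued functions\<close>

text \<open>The bound involves \<open>g\<close> only through \<open>K\<close>, so it serves all
  coordinates of a bounded family at once; this uniformity turns coordinatewise derivatives into
  derivatives in linf. The constant is 2! / (r/4)^2, from Cauchy's inequality for the second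
  derivative, which controls the Taylor remainder.\<close>

lemma difference_quotient_estimate:
  assumes hol: "g holomorphic_on ball z r" and K: "\<And>w. w \<in> ball z r \<Longrightarrow> cmod (g w) \<le> K"
    and w: "w \<in> ball z (r/2)" "w \<noteq> z"
  shows "cmod ((g w - g z) / (w - z) - deriv g z) \<le> 32 * K / r\<^sup>2 * cmod (w - z)"
proof -
  have r: "r > 0" using w(1) by (metis ball_empty empty_iff half_gt_zero_iff not_le)
  have sub: "ball z (r/2) \<subseteq> ball z r" using r by auto
  have B: "cmod ((deriv ^^ 2) g x) \<le> 32 * K / r\<^sup>2" if x: "x \<in> ball z (r/2)" for x
  proof -
    have c: "cball x (r/4) \<subseteq> ball z r"
    proof
      fix y assume "y \<in> cball x (r/4)"
      then show "y \<in> ball z r" using x r dist_triangle[of z y x] by simp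
    qed
    have "cmod ((deriv ^^ 2) g x) \<le> fact 2 * K / (r/4)^2"
    proof (rule Cauchy_inequality)
      show "g holomorphic_on ball x (r/4)"
        using hol c by (meson ball_subset_cball holomorphic_on_subset order_trans)
      show "continuous_on (cball x (r/4)) g"
        using hol c by (meson holomorphic_on_subset holomorphic_on_imp_continuous_on)
      show "cmod (g y) \<le> K" if "cmod (x - y) = r/4" for y
        using c that by (intro K) (auto simp: dist_norm)
    qed (use r in auto)
    then show ?thesis by (simp add: power_divide)
  qed
  have "cmod ((deriv ^^ 0) g w - (\<Sum>i\<le>1. (deriv ^^ i) g z * (w - z) ^ i / fact i))
      \<le> 32 * K / r\<^sup>2 * cmod (w - z) ^ Suc 1 / fact 1"
  proof (rule complex_Taylor[where S = "ball z (r/2)"])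
    fix i x assume "x \<in> ball z (r/2)" "i \<le> (1::nat)"
    then show "((deriv ^^ i) g has_field_derivative (deriv ^^ Suc i) g x) (at x within ball z (r/2))"
      using holomorphic_higher_deriv[OF hol open_ball, of i] sub
      by (auto intro!: holomorphic_derivI[of _ "ball z r"])
  qed (use B w r in \<open>auto simp: numeral_2_eq_2\<close>)
  then have "cmod (g w - g z - deriv g z * (w - z)) \<le> 32 * K / r\<^sup>2 * cmod (w - z) * cmod (w - z)"
    by (simp add: power2_eq_square algebra_simps)
  moreover have "(g w - g z) / (w - z) - deriv g z = (g w - g z - deriv g z * (w - z)) / (w - z)"
    using w by (simp add: field_simps)
  ultimately show ?thesis using w by (simp add: norm_divide divide_le_eq)
qed

lemma norm_deriv_le:
  assumes hol: "g holomorphic_on ball z r" and K: "\<And>w. w \<in> ball z r \<Longrightarrow> cmod (g w) \<le> K"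
    and "0 < s" "s < r"
  shows "cmod ((deriv ^^ k) g z) \<le> fact k * K / s ^ k"
proof (rule Cauchy_inequality)
  show "g holomorphic_on ball z s"
    using assms by (auto intro: holomorphic_on_subset[OF hol])
  show "continuous_on (cball z s) g"
    using assms by (intro holomorphic_on_imp_continuous_on holomorphic_on_subset[OF hol]) auto
  show "cmod (g x) \<le> K" if "cmod (z - x) = s" for x
    using that assms by (intro K) (auto simp: dist_norm)
qed fact

lemma has_cderivI:
  assumes hol: "\<And>n. (\<lambda>w. G w n) holomorphic_on ball z r" and r: "r > 0"
    and K: "\<And>n w. w \<in> ball z r \<Longrightarrow> cmod (G w n) \<le> K"
  shows "has_cderiv (sum_space linf l1) G (\<lambda>n. deriv (\<lambda>w. G w n) z) z"
proof -
  have "bounded (range (\<lambda>n. deriv (\<lambda>w. G w n) z))"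
    using norm_deriv_le[OF hol K, of "r/2" 1] r by (auto simp: bounded_iff)
  moreover have "uniform_limit UNIV (\<lambda>w n. (G w n - G z n) / (w - z)) (\<lambda>n. deriv (\<lambda>w. G w n) z) (at z)"
    unfolding uniform_limit_iff
  proof (intro allI impI)
    fix e :: real assume "e > 0"
    have "((\<lambda>w. 32 * K / r\<^sup>2 * cmod (w - z)) \<longlongrightarrow> 32 * K / r\<^sup>2 * cmod (z - z)) (at z)"
      by (intro tendsto_intros)
    then have "\<forall>\<^sub>F w in at z. 32 * K / r\<^sup>2 * cmod (w - z) < e"
      using \<open>e > 0\<close> by (intro order_tendstoD(2)) auto
    moreover have "\<forall>\<^sub>F w in at z. w \<in> ball z (r/2) \<and> w \<noteq> z"
      using r eventually_at_in_open[of "ball z (r/2)" z] by simp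
    ultimately show "\<forall>\<^sub>F w in at z. \<forall>n\<in>UNIV. dist ((G w n - G z n) / (w - z)) (deriv (\<lambda>w. G w n) z) < e"
    proof eventually_elim
      case (elim w)
      then show ?case
        using difference_quotient_estimate[OF hol K, of w] by (auto simp: dist_norm intro: le_less_trans)
    qed
  qed
  ultimately show ?thesis by (simp add: has_cderiv_def tends_in_sum_space tends_in_linf)
qed

lemma has_cderiv_coordinate:
  assumes "has_cderiv (sum_space linf l1) F D z"
  shows "((\<lambda>w. F w n) has_field_derivative D n) (at z)"
  using tends_in_linf_coordinate[of _ D "at z" n] assms
  by (simp add: has_cderiv_def tends_in_sum_space has_field_derivative_iff)

lemma cderiv_eq:
  assumes "has_cderiv (sum_space linf l1) F D z"
  shows "cderiv (sum_space linf l1) F z = D"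
  unfolding cderiv_def
  by (rule the_equality[where a = D])
    (use assms DERIV_unique has_cderiv_coordinate in blast)+

lemma cderiv_coordinates:
  assumes hol: "\<And>n. (\<lambda>w. G w n) holomorphic_on S" "open S"
    and K: "\<And>n w. w \<in> S \<Longrightarrow> cmod (G w n) \<le> K" and z: "z \<in> S"
  shows "cderiv (sum_space linf l1) G z = (\<lambda>n. deriv (\<lambda>w. G w n) z)"
proof -
  obtain r where "r > 0" "ball z r \<subseteq> S" using assms by (auto elim: openE)
  then show ?thesis
    by (intro cderiv_eq has_cderivI[where r = r and K = K] holomorphic_on_subset[OF hol(1)] K) auto
qed

text \<open>On a smaller ball Cauchy's inequality bounds the first derivatives uniformly in
  \<open>n\<close>, so \<open>cderiv_coordinates\<close> applies a second time, now to
  \<open>?D\<close>.\<close>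

lemma cderiv2_coordinates:
  assumes hol: "\<And>n. (\<lambda>w. G w n) holomorphic_on S" "open S"
    and K: "\<And>n w. w \<in> S \<Longrightarrow> cmod (G w n) \<le> K" and z: "z \<in> S"
  shows "(cderiv (sum_space linf l1) ^^ 2) G z = (\<lambda>n. (deriv ^^ 2) (\<lambda>w. G w n) z)"
proof -
  obtain r where r: "r > 0" "ball z r \<subseteq> S" using assms by (auto elim: openE)
  then have sub: "ball z (r/2) \<subseteq> S" by (auto simp: subset_eq)
  let ?D = "cderiv (sum_space linf l1) G"
  have D: "?D w n = deriv (\<lambda>w. G w n) w" if "w \<in> S" for w n
    using cderiv_coordinates[OF hol K that] by simp
  have hol': "(\<lambda>w. ?D w n) holomorphic_on ball z (r/2)" for n
    by (rule holomorphic_transform[of "deriv (\<lambda>w. G w n)"])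
      (use holomorphic_deriv[OF holomorphic_on_subset[OF hol(1) sub] open_ball] sub D in \<open>auto simp: subset_iff\<close>)
  have K': "cmod (?D w n) \<le> fact 1 * K / (r/4) ^ 1" if "w \<in> ball z (r/2)" for w n
  proof -
    have sub': "ball w (r/2) \<subseteq> S"
    proof
      fix y assume "y \<in> ball w (r/2)"
      then show "y \<in> S" using that r(2) dist_triangle[of z y w] by (auto simp: subset_eq)
    qed
    have "cmod ((deriv ^^ 1) (\<lambda>w. G w n) w) \<le> fact 1 * K / (r/4) ^ 1"
      by (rule norm_deriv_le[where r = "r/2"]) (use sub' r K in \<open>auto intro: holomorphic_on_subset[OF hol(1) sub']\<close>)
    moreover have "w \<in> S" using that sub by auto
    ultimately show ?thesis using D[of w n] by simp
  qed
  have "cderiv (sum_space linf l1) ?D z = (\<lambda>n. deriv (\<lambda>w. ?D w n) z)"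
    by (rule cderiv_coordinates[where S = "ball z (r/2)"]) (use hol' K' r in auto)
  also have "\<dots> = (\<lambda>n. deriv (deriv (\<lambda>w. G w n)) z)"
  proof (rule ext, rule deriv_cong_ev[OF _ refl])
    fix n
    have "\<forall>\<^sub>F w in nhds z. w \<in> S" using hol(2) z by (rule eventually_nhds_in_open)
    then show "\<forall>\<^sub>F w in nhds z. ?D w n = deriv (\<lambda>w. G w n) w"
      by eventually_elim (use D in auto)
  qed
  finally show ?thesis by (simp add: numeral_2_eq_2)
qed

subsection \<open>The Calderon space\<close>

lemma open_open_strip: "open open_strip"
  unfolding open_strip_def by (intro open_Collect_conj open_halfspace_Re_gt open_halfspace_Re_lt)

lemma half_in_open_strip: "1/2 \<in> open_strip"
  by (simp add: open_strip_def)

lemma open_strip_subset: "open_strip \<subseteq> strip"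
  by (auto simp: open_strip_def strip_def)

lemma Complex_in_strip [simp]: "Complex 0 t \<in> strip" "Complex 1 t \<in> strip"
  by (auto simp: strip_def)

lemma calderon_bounded:
  assumes "F \<in> calderon linf l1"
  obtains K where "\<And>z n. cmod (F z n) \<le> K" "K \<ge> 0"
proof -
  obtain K where K: "\<And>z. z \<in> strip \<Longrightarrow> \<bar>nrm (sum_space linf l1) (F z)\<bar> \<le> K"
    using assms by (auto simp: calderon_def bounded_iff)
  have "cmod (F z n) \<le> max K 0" for z n
  proof (cases "z \<in> strip")
    case True
    then have "F z \<in> points linf" using assms by (auto simp: calderon_def points_sum_space)
    then show ?thesis
      using norm_le_nrm_linf[of "F z" n] K[OF True] nrm_sum_space[of "F z"] by simp
  next
    case False
    then have "F z = (\<lambda>n. 0)" using assms by (auto simp: calderon_def)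
    then show ?thesis by simp
  qed
  then show thesis by (rule that) simp
qed

lemma calderon_continuous: "F \<in> calderon linf l1 \<Longrightarrow> continuous_on strip (\<lambda>z. F z n)"
  by (auto simp: calderon_def continuous_in_def tends_in_sum_space continuous_on
      intro!: tends_in_linf_coordinate)

lemma calderon_holomorphic: "F \<in> calderon linf l1 \<Longrightarrow> (\<lambda>z. F z n) holomorphic_on open_strip"
  unfolding holomorphic_on_open[OF open_open_strip]
  by (auto simp: calderon_def dest!: bspec intro: has_cderiv_coordinate)

lemma bdd_above_range_of_null_at_infinity:
  fixes g :: "real \<Rightarrow> real"
  assumes "continuous_on UNIV g" "(g \<longlongrightarrow> 0) at_infinity"
  shows "bdd_above (range g)"
proof -
  have "\<forall>\<^sub>F t in at_infinity. g t < 1" using assms(2) by (intro order_tendstoD) auto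
  then obtain b where b: "\<And>t. b \<le> \<bar>t\<bar> \<Longrightarrow> g t < 1" by (auto simp: eventually_at_infinity)
  have "compact (g ` {-b..b})"
    by (intro compact_continuous_image continuous_on_subset[OF assms(1)]) auto
  then have "bdd_above (g ` {-b..b})"
    by (intro bounded_imp_bdd_above compact_imp_bounded)
  then obtain M where M: "\<And>t. t \<in> {-b..b} \<Longrightarrow> g t \<le> M" unfolding bdd_above_def by blast
  have "g t \<le> max M 1" for t
    using M[of t] b[of t] by (cases "b \<le> \<bar>t\<bar>") (auto simp: not_le abs_less_iff)
  then show ?thesis by (rule bdd_aboveI2)
qed

lemma calderon_norm_left:
  assumes F: "F \<in> calderon linf l1"
  shows "cmod (F (Complex 0 t) n) \<le> calderon_norm linf l1 F"
proof -
  obtain K where K: "\<And>z n. cmod (F z n) \<le> K" using calderon_bounded[OF F] by blast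
  have "cmod (F (Complex 0 t) n) \<le> nrm linf (F (Complex 0 t))"
    by (rule norm_le_nrm_linf[OF points_linfI[OF K]])
  also have "\<dots> \<le> (SUP t. nrm linf (F (Complex 0 t)))"
    by (rule cSUP_upper) (auto intro!: bdd_aboveI2 nrm_linf_le K)
  also have "\<dots> \<le> calderon_norm linf l1 F" by (simp add: calderon_norm_def)
  finally show ?thesis .
qed

text \<open>On the right line the sum-space norm controls only the supremum of the coordinates.
  Boundedness of the l1 norm, without which the \<open>SUP\<close> in \<open>calderon_norm\<close>
  says nothing, comes from its continuity in \<open>t\<close> and its decay at infinity.\<close>

lemma calderon_norm_right:
  assumes F: "F \<in> calderon linf l1"
  shows "F (Complex 1 t) \<in> points l1" "nrm l1 (F (Complex 1 t)) \<le> calderon_norm linf l1 F"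
proof -
  have cont: "tends_in l1 (\<lambda>t. F (Complex 1 t)) (F (Complex 1 t)) (at t)" for t
    using F by (simp add: calderon_def continuous_in_def)
  then show "F (Complex 1 t) \<in> points l1" by (simp add: tends_in_def)
  have "bdd_above (range (\<lambda>t. nrm l1 (F (Complex 1 t))))"
  proof (rule bdd_above_range_of_null_at_infinity)
    show "continuous_on UNIV (\<lambda>t. nrm l1 (F (Complex 1 t)))"
      using tends_in_l1_nrm[OF cont] by (simp add: continuous_on)
    have "tends_in l1 (\<lambda>t. F (Complex 1 t)) (\<lambda>n. 0) at_infinity"
      using F by (simp add: calderon_def)
    from tends_in_l1_nrm[OF this] show "((\<lambda>t. nrm l1 (F (Complex 1 t))) \<longlongrightarrow> 0) at_infinity"
      by (simp add: nrm_l1)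
  qed
  then have "nrm l1 (F (Complex 1 t)) \<le> (SUP t. nrm l1 (F (Complex 1 t)))"
    by (rule cSUP_upper[rotated]) simp
  then show "nrm l1 (F (Complex 1 t)) \<le> calderon_norm linf l1 F"
    by (simp add: calderon_norm_def)
qed

lemma calderon_norm_nonneg: "F \<in> calderon linf l1 \<Longrightarrow> 0 \<le> calderon_norm linf l1 F"
  using calderon_norm_left[of F 0 0] norm_ge_zero order_trans by blast

lemma Delta_coordinates:
  assumes F: "F \<in> calderon linf l1" and "k \<le> 2"
  shows "Delta linf l1 k F = (\<lambda>n. (deriv ^^ k) (\<lambda>z. F z n) (1/2) / fact k)"
proof -
  obtain K where K: "\<And>z n. cmod (F z n) \<le> K" using calderon_bounded[OF F] by blast
  note hol = calderon_holomorphic[OF F] and op = open_open_strip and half = half_in_open_strip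
  from \<open>k \<le> 2\<close> consider "k = 0" | "k = 1" | "k = 2" by linarith
  then show ?thesis
  proof cases
    case 2
    then show ?thesis using cderiv_coordinates[OF hol op K half] by (simp add: Delta_def)
  next
    case 3
    then show ?thesis using cderiv2_coordinates[OF hol op K half] by (simp add: Delta_def)
  qed (simp add: Delta_def)
qed

section \<open>Elements of the Calderon space obtained from majorants\<close>

lemma uniform_limit_null_sequence_dominated:
  fixes g :: "'a \<Rightarrow> nat \<Rightarrow> complex"
  assumes lim: "\<And>n. ((\<lambda>s. g s n) \<longlongrightarrow> l n) A" and c: "c \<longlonglongrightarrow> 0"
    and g: "\<forall>\<^sub>F s in A. \<forall>n. cmod (g s n) \<le> c n" and l: "\<And>n. cmod (l n) \<le> c n"
  shows "uniform_limit UNIV g l A"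
proof (rule uniform_limitI)
  fix e :: real assume e: "e > 0"
  \<comment> \<open>The majorant settles all coordinates from \<open>N\<close> on; the finitely many
    others converge one by one.\<close>
  then have "\<forall>\<^sub>F n in sequentially. c n < e / 2" using c by (intro order_tendstoD) auto
  then obtain N where N: "\<And>n. n \<ge> N \<Longrightarrow> c n < e / 2" by (auto simp: eventually_sequentially)
  have "\<forall>\<^sub>F s in A. \<forall>n\<in>{..<N}. dist (g s n) (l n) < e"
    by (intro eventually_ball_finite ballI tendstoD lim e) auto
  with g show "\<forall>\<^sub>F s in A. \<forall>n\<in>UNIV. dist (g s n) (l n) < e"
  proof eventually_elim
    case (elim s)
    show ?case
    proof
      fix n
      show "dist (g s n) (l n) < e"
      proof (cases "n < N")
        case False
        then have "cmod (g s n) + cmod (l n) < e"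
          using N[of n] elim(1)[rule_format, of n] l[of n] by linarith
        then show ?thesis using norm_triangle_ineq4[of "g s n" "l n"] by (simp add: dist_norm)
      qed (use elim in auto)
    qed
  qed
qed

lemma tends_in_l1_dominated:
  assumes lim: "\<And>n. ((\<lambda>s. g s n) \<longlongrightarrow> l n) A" and c: "summable c"
    and g: "\<forall>\<^sub>F s in A. \<forall>n. cmod (g s n) \<le> c n" and l: "\<And>n. cmod (l n) \<le> c n"
  shows "tends_in l1 g l A"
proof -
  have mem: "x \<in> points l1" if "\<And>n. cmod (x n) \<le> c n" for x
    unfolding points_l1 using summable_comparison_test'[OF c, of 0 "\<lambda>n. cmod (x n)"] that by simp
  have "((\<lambda>s. \<Sum>n. cmod (g s n - l n)) \<longlongrightarrow> (\<Sum>n. 0)) A"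
  \<comment> \<open>Tannery's theorem asks for a proper filter; along \<open>bot\<close> every limit
    statement holds.\<close>
  proof (cases "A = bot")
    case False
    show ?thesis
    proof (rule tannerys_theorem[where a = "\<lambda>n s. cmod (g s n - l n)" and b = "\<lambda>n. 0"
          and M = "\<lambda>n. 2 * c n", THEN conjunct2, THEN conjunct2])
      show "((\<lambda>s. cmod (g s n - l n)) \<longlongrightarrow> 0) A" for n
        using lim[of n] by (intro tendsto_norm_zero LIM_zero)
      have "\<forall>\<^sub>F s in A. \<forall>n. norm (cmod (g s n - l n)) \<le> 2 * c n"
        using g
      proof eventually_elim
        case (elim s)
        show ?case
        proof
          fix n show "norm (cmod (g s n - l n)) \<le> 2 * c n"
            using norm_triangle_ineq4[of "g s n" "l n"] elim[rule_format, of n] l[of n] by simp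
        qed
      qed
      then show "\<forall>\<^sub>F (k, s) in at_top \<times>\<^sub>F A. norm (cmod (g s k - l k)) \<le> 2 * c k"
        unfolding eventually_prod_filter
        by (intro exI[of _ "\<lambda>_. True"] exI[of _ "\<lambda>s. \<forall>n. norm (cmod (g s n - l n)) \<le> 2 * c n"]) simp
    qed (use c False in \<open>auto intro: summable_mult\<close>)
  qed simp
  then show ?thesis
    using g l by (auto simp: tends_in_def nrm_l1 intro!: mem elim!: eventually_mono)
qed

text \<open>The null sequence \<open>e\<close> majorises on the whole strip and gives continuity
  into the sum space and into linf; the summable \<open>a\<close> majorises on the right line and
  gives continuity into l1; \<open>h\<close> gives the decay along both lines.\<close>

lemma calderonI:
  fixes \<phi> :: "complex \<Rightarrow> nat \<Rightarrow> complex" and h :: "real \<Rightarrow> real"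
  assumes hol: "\<And>n. (\<lambda>z. \<phi> z n) holomorphic_on UNIV"
    and h: "\<And>t. 0 \<le> h t" "\<And>t. h t \<le> K" "(h \<longlongrightarrow> 0) at_infinity"
    and e: "\<And>z n. z \<in> strip \<Longrightarrow> cmod (\<phi> z n) \<le> e n * h (Im z)" "e \<longlonglongrightarrow> 0"
      "\<And>n. 0 \<le> e n" "\<And>n. e n \<le> C"
    and a: "\<And>t n. cmod (\<phi> (Complex 1 t) n) \<le> a n * h t" "summable a"
      "\<And>n. 0 \<le> a n" "suminf a \<le> C"
  defines "F \<equiv> \<lambda>z. if z \<in> strip then \<phi> z else (\<lambda>n. 0)"
  shows "F \<in> calderon linf l1" "calderon_norm linf l1 F \<le> C * K"
proof -
  have K: "0 \<le> K" using h(1,2)[of 0] by linarith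
  have C: "0 \<le> C" using e(3,4)[of 0] by linarith
  have \<phi>e: "cmod (\<phi> z n) \<le> e n * K" if "z \<in> strip" for z n
    by (rule order_trans[OF e(1)[OF that] mult_left_mono[OF h(2) e(3)]])
  have \<phi>a: "cmod (\<phi> (Complex 1 t) n) \<le> a n * K" for t n
    by (rule order_trans[OF a(1) mult_left_mono[OF h(2) a(3)]])
  have eK: "(\<lambda>n. e n * K) \<longlonglongrightarrow> 0" using tendsto_mult_right[OF e(2), of K] by simp
  have aK: "summable (\<lambda>n. a n * K)" using a(2) by (rule summable_mult2)
  have \<phi>C: "cmod (\<phi> z n) \<le> C * K" if "z \<in> strip" for z n
    by (rule order_trans[OF \<phi>e[OF that] mult_right_mono[OF e(4) K]])
  have mem: "F z \<in> points linf" for z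
    by (rule points_linfI[where K = "C * K"]) (use \<phi>C C K in \<open>auto simp: F_def\<close>)
  have cont: "isCont (\<lambda>z. \<phi> z n) z" for z n
    using holomorphic_on_imp_continuous_on[OF hol[of n]] by (simp add: continuous_on_eq_continuous_at)
  have lim: "((\<lambda>w. F w n) \<longlongrightarrow> F z n) (at z within strip)" if "z \<in> strip" for z n
  proof (rule Lim_transform_eventually)
    show "((\<lambda>w. \<phi> w n) \<longlongrightarrow> F z n) (at z within strip)"
      using cont[of z n] that by (auto simp: F_def isCont_def intro: tendsto_within_subset)
    show "\<forall>\<^sub>F w in at z within strip. \<phi> w n = F w n"
      by (auto simp: F_def eventually_at_filter)
  qed
  have contC: "((\<lambda>t. F (Complex u t) n) \<longlongrightarrow> F (Complex u s) n) (at s)"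
    if "u = 0 \<or> u = 1" for u s n
  proof -
    have "((\<lambda>t. \<phi> (Complex u t) n) \<longlongrightarrow> \<phi> (Complex u s) n) (at s)"
      by (rule isCont_tendsto_compose[OF cont]) (intro tendsto_intros)
    then show ?thesis using that by (auto simp: F_def)
  qed
  have Fe: "cmod (F z n) \<le> e n * K" for z n
    using \<phi>e[of z n] e(3)[of n] K by (auto simp: F_def)
  have limC: "((\<lambda>t. F (Complex u t) n) \<longlongrightarrow> 0) at_infinity" if "u = 0 \<or> u = 1" for u n
  proof (rule Lim_null_comparison)
    show "((\<lambda>t. e n * h t) \<longlongrightarrow> 0) at_infinity" using tendsto_mult_left[OF h(3)] by fastforce
    show "\<forall>\<^sub>F t in at_infinity. cmod (F (Complex u t) n) \<le> e n * h t"
      using that e(1)[of "Complex 0 _"] e(1)[of "Complex 1 _"] by (auto simp: F_def)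
  qed
  have Fa: "cmod (F (Complex 1 t) n) \<le> a n * K" for t n using \<phi>a by (simp add: F_def)
  have 1: "continuous_in (sum_space linf l1) strip F"
    unfolding continuous_in_def tends_in_sum_space tends_in_linf
    using mem by (auto simp: points_linf intro!: uniform_limit_null_sequence_dominated[OF _ eK] lim Fe
        always_eventually)
  have 2: "continuous_in linf UNIV (\<lambda>t. F (Complex 0 t))"
    unfolding continuous_in_def tends_in_linf
    using mem by (auto simp: points_linf intro!: uniform_limit_null_sequence_dominated[OF _ eK] contC Fe
        always_eventually)
  have 3: "tends_in linf (\<lambda>t. F (Complex 0 t)) (\<lambda>n. 0) at_infinity"
    unfolding tends_in_linf
    using e(3) K by (auto intro!: uniform_limit_null_sequence_dominated[OF _ eK] limC Fe
        always_eventually)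
  have 4: "continuous_in l1 UNIV (\<lambda>t. F (Complex 1 t))"
    unfolding continuous_in_def
    by (auto intro!: tends_in_l1_dominated[OF _ aK] contC Fa always_eventually)
  have 5: "tends_in l1 (\<lambda>t. F (Complex 1 t)) (\<lambda>n. 0) at_infinity"
    using a(3) K by (auto intro!: tends_in_l1_dominated[OF _ aK] limC Fa always_eventually)
  have 6: "\<exists>D. has_cderiv (sum_space linf l1) F D z" if z: "z \<in> open_strip" for z
  proof -
    obtain r where r: "r > 0" "ball z r \<subseteq> open_strip"
      using open_open_strip z by (auto elim: openE)
    show ?thesis
    proof (rule exI, rule has_cderivI)
      show "(\<lambda>w. F w n) holomorphic_on ball z r" for n
        by (rule holomorphic_transform[of "\<lambda>w. \<phi> w n"])
          (use r open_strip_subset in \<open>auto simp: F_def intro: holomorphic_on_subset[OF hol]\<close>)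
      show "cmod (F w n) \<le> C * K" if "w \<in> ball z r" for n w
        using \<phi>C[of w n] C K by (auto simp: F_def)
    qed fact
  qed
  have nC: "cmod (F z n) \<le> C * K" for z n using \<phi>C[of z n] C K by (auto simp: F_def)
  have "bounded ((\<lambda>z. nrm (sum_space linf l1) (F z)) ` strip)"
  proof -
    have "\<bar>nrm (sum_space linf l1) (F z)\<bar> \<le> C * K" for z
      using nrm_linf_le[OF nC] order_trans[OF norm_ge_zero norm_le_nrm_linf[OF mem]]
      by (simp add: nrm_sum_space[OF mem])
    then show ?thesis by (auto simp: bounded_iff)
  qed
  then show "F \<in> calderon linf l1"
    using 1 2 3 4 5 6 mem by (simp add: calderon_def points_sum_space) (simp add: F_def)
  have "nrm linf (F (Complex 0 t)) \<le> C * K" for t by (rule nrm_linf_le[OF nC])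
  moreover have "nrm l1 (F (Complex 1 t)) \<le> C * K" for t
  proof -
    have "nrm l1 (F (Complex 1 t)) \<le> (\<Sum>n. a n * K)"
      unfolding nrm_l1
      by (rule suminf_le[OF Fa _ aK], rule summable_comparison_test'[OF aK, of 0]) (use Fa in simp)
    also have "\<dots> = suminf a * K" using suminf_mult2[OF a(2), of K] by simp
    also have "\<dots> \<le> C * K" by (rule mult_right_mono[OF a(4) K])
    finally show ?thesis .
  qed
  ultimately show "calderon_norm linf l1 F \<le> C * K"
    by (auto simp: calderon_norm_def intro!: cSUP_least)
qed

subsection \<open>The kernel\<close>

definition decay :: "real \<Rightarrow> real" where
  "decay t = 256 / (2 + \<bar>t\<bar>)"

lemma decay_nonneg: "0 \<le> decay t"
  by (simp add: decay_def)

lemma decay_le: "decay t \<le> 128"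
  by (simp add: decay_def divide_le_eq)

lemma decay_null: "(decay \<longlongrightarrow> 0) at_infinity"
proof -
  have "filterlim (\<lambda>t::real. 2 + \<bar>t\<bar>) at_top at_infinity"
    using filterlim_at_infinity_imp_norm_at_top[OF filterlim_ident[of "at_infinity :: real filter"]]
    by (intro filterlim_tendsto_add_at_top[OF tendsto_const]) simp
  then show ?thesis
    unfolding decay_def by (intro tendsto_divide_0[OF tendsto_const] filterlim_at_top_imp_at_infinity)
qed

text \<open>The cube is what the polynomial factors of \<open>kernel\<close> leave: one power from
  the linear factor, two from the quadratic one. A fourth power clears the denominator of
  \<open>decay\<close>, and (2 + |t|)^4 is at most 128 exp(t^2) by the quadratic Taylor bound; hence
  256 = 2 * 128 in \<open>decay\<close>.\<close>

lemma gaussian_le_decay: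
  "2 * (2 + \<bar>t\<bar>) ^ 3 * exp (- t\<^sup>2) \<le> decay t"
proof -
  have sq: "(2 + \<bar>t\<bar>)\<^sup>2 \<le> 2 * (4 + t\<^sup>2)"
    using sum_squares_bound[of 2 "\<bar>t\<bar>"] by (simp add: power2_sum)
  have "(2 + \<bar>t\<bar>) ^ 4 = ((2 + \<bar>t\<bar>)\<^sup>2)\<^sup>2" by simp
  also have "\<dots> \<le> (2 * (4 + t\<^sup>2))\<^sup>2" by (rule power_mono[OF sq]) simp
  also have "\<dots> \<le> 128 * (1 + t\<^sup>2 + (t\<^sup>2)\<^sup>2 / 2)"
    using sum_squares_bound[of 4 "t\<^sup>2"] by (simp add: power2_sum power_mult_distrib)
  also have "\<dots> \<le> 128 * exp (t\<^sup>2)" using exp_lower_Taylor_quadratic[of "t\<^sup>2"] by simp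
  finally have "(2 + \<bar>t\<bar>) ^ 4 * exp (- t\<^sup>2) \<le> 128 * exp (t\<^sup>2) * exp (- t\<^sup>2)"
    by (rule mult_right_mono) simp
  also have "\<dots> = 128" by (simp add: mult.assoc flip: exp_add)
  finally have "(2 + \<bar>t\<bar>) ^ 3 * exp (- t\<^sup>2) * (2 + \<bar>t\<bar>) \<le> 128"
    by (simp add: power4_eq_xxxx power3_eq_cube mult_ac)
  moreover have "0 < 2 + \<bar>t\<bar>" by simp
  ultimately show ?thesis unfolding decay_def by (subst pos_le_divide_eq) linarith+
qed

text \<open>The factor \<open>exp(w\<^sup>2) (1 - w\<^sup>2)\<close> makes the kernel small at infinity and is
  \<open>1 + O(w\<^sup>4)\<close> for \<open>w = z - 1/2\<close>, so it does not disturb the first three Taylor coefficients.\<close>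

definition kernel :: "real \<Rightarrow> real \<Rightarrow> real \<Rightarrow> complex \<Rightarrow> complex" where
  "kernel p q s z = (let w = z - 1/2 in
     (of_real p + of_real q * w) * (1 - w\<^sup>2) * exp (w\<^sup>2 - 2 * of_real s * w))"

lemma kernel_holomorphic: "kernel p q s holomorphic_on S"
  unfolding kernel_def Let_def by (intro holomorphic_intros)

lemma
  shows kernel_half: "kernel p q s (1/2) = of_real p"
    and deriv_kernel_half: "deriv (kernel p q s) (1/2) = of_real (q - 2 * s * p)"
    and deriv2_kernel_half: "(deriv ^^ 2) (kernel p q s) (1/2) = of_real (4 * s * (s * p - q))"
proof -
  define E where "E z = exp ((z - 1/2)\<^sup>2 - 2 * complex_of_real s * (z - 1/2))" for z
  have E: "(E has_field_derivative (2 * (z - 1/2) - 2 * of_real s) * E z) (at z)" for z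
    unfolding E_def by (rule derivative_eq_intros refl | simp)+
  have E1: "E (1/2) = 1" by (simp add: E_def)
  have kernel: "kernel p q s = (\<lambda>z. (of_real p + of_real q * (z - 1/2)) * (1 - (z - 1/2)\<^sup>2) * E z)"
    by (simp add: kernel_def E_def fun_eq_iff Let_def)
  let ?d = "\<lambda>z. (of_real q * (1 - (z - 1/2)\<^sup>2)
      - 2 * (z - 1/2) * (of_real p + of_real q * (z - 1/2))
      + (of_real p + of_real q * (z - 1/2)) * (1 - (z - 1/2)\<^sup>2) * (2 * (z - 1/2) - 2 * of_real s)) * E z"
  show "kernel p q s (1/2) = of_real p" by (simp add: kernel E1)
  have "(kernel p q s has_field_derivative ?d z) (at z)" for z
    unfolding kernel by (rule derivative_eq_intros E refl | simp)+ (simp add: field_simps power2_eq_square)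
  then have d: "deriv (kernel p q s) = ?d" by (intro ext DERIV_imp_deriv)
  then show "deriv (kernel p q s) (1/2) = of_real (q - 2 * s * p)" by (simp add: E1)
  have "(?d has_field_derivative of_real (4 * s * (s * p - q))) (at (1/2))"
    by (rule derivative_eq_intros E refl | simp)+ (simp add: E1 algebra_simps)
  then show "(deriv ^^ 2) (kernel p q s) (1/2) = of_real (4 * s * (s * p - q))"
    using d DERIV_imp_deriv by (simp add: numeral_2_eq_2)
qed

text \<open>For \<open>w = z - 1/2\<close> the modulus of exp(w^2) is exp((Re w)^2 - t^2), at most 2
  exp(- t^2), and - 2 s Re w = s (1 - 2 Re z). The exponential factor is therefore exp(s) on the
  left line and exp(- s) on the right line.\<close>

lemma norm_kernel_le:
  assumes z: "z \<in> strip" and p: "\<bar>p\<bar> \<le> G" and q: "\<bar>q\<bar> \<le> G"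
  shows "cmod (kernel p q s z) \<le> G * exp (s * (1 - 2 * Re z)) * decay (Im z)"
proof -
  define w where "w = z - 1/2"
  define t where "t = Im z"
  have w: "Re w = Re z - 1/2" "Im w = t" by (auto simp: w_def t_def)
  have Re_w: "\<bar>Re w\<bar> \<le> 1/2" using z by (intro abs_leI) (auto simp: w strip_def)
  have "0 \<le> G" using p by linarith
  have 1: "1 + cmod w \<le> 2 + \<bar>t\<bar>" using cmod_le[of w] Re_w w by simp
  have "cmod (of_real p + of_real q * w) \<le> \<bar>p\<bar> + \<bar>q\<bar> * cmod w"
    by (rule norm_triangle_le) (simp add: norm_mult)
  also have "\<dots> \<le> G + G * cmod w" by (intro add_mono mult_right_mono p q) simp
  also have "\<dots> = G * (1 + cmod w)" by (simp add: algebra_simps)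
  also have "\<dots> \<le> G * (2 + \<bar>t\<bar>)" using 1 \<open>0 \<le> G\<close> by (rule mult_left_mono)
  finally have lin: "cmod (of_real p + of_real q * w) \<le> G * (2 + \<bar>t\<bar>)" .
  have "cmod (1 - w\<^sup>2) \<le> 1 + (cmod w)\<^sup>2" using norm_triangle_ineq4[of 1 "w\<^sup>2"] by (simp add: norm_power)
  also have "\<dots> \<le> (1 + cmod w)\<^sup>2" by (simp add: power2_sum)
  also have "\<dots> \<le> (2 + \<bar>t\<bar>)\<^sup>2" using 1 by (rule power_mono) simp
  finally have quad: "cmod (1 - w\<^sup>2) \<le> (2 + \<bar>t\<bar>)\<^sup>2" .
  have "(Re w)\<^sup>2 \<le> (1/2)\<^sup>2" using Re_w by (simp only: abs_le_square_iff[symmetric])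
  then have "exp ((Re w)\<^sup>2) \<le> exp (1/4)" by (simp add: power2_eq_square)
  also have "\<dots> \<le> 2" using exp_bound[of "1/4"] by (simp add: power2_eq_square)
  finally have e: "exp ((Re w)\<^sup>2) \<le> 2" .
  have "cmod (exp (w\<^sup>2 - 2 * of_real s * w)) = exp ((Re w)\<^sup>2) * (exp (- t\<^sup>2) * exp (s * (1 - 2 * Re z)))"
    by (simp add: norm_exp_eq_Re w power2_eq_square algebra_simps flip: exp_add)
  also have "\<dots> \<le> 2 * (exp (- t\<^sup>2) * exp (s * (1 - 2 * Re z)))"
    by (rule mult_right_mono[OF e]) simp
  finally have "cmod (exp (w\<^sup>2 - 2 * of_real s * w)) \<le> 2 * (exp (- t\<^sup>2) * exp (s * (1 - 2 * Re z)))" .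
  with lin quad have "cmod (kernel p q s z)
      \<le> (G * (2 + \<bar>t\<bar>)) * (2 + \<bar>t\<bar>)\<^sup>2 * (2 * (exp (- t\<^sup>2) * exp (s * (1 - 2 * Re z))))"
    unfolding kernel_def Let_def norm_mult w_def[symmetric]
    using \<open>0 \<le> G\<close> by (intro mult_mono) auto
  also have "\<dots> = G * exp (s * (1 - 2 * Re z)) * (2 * (2 + \<bar>t\<bar>) ^ 3 * exp (- t\<^sup>2))"
    by (simp add: power_numeral_reduce algebra_simps)
  also have "\<dots> \<le> G * exp (s * (1 - 2 * Re z)) * decay t"
    using \<open>0 \<le> G\<close> by (intro mult_left_mono gaussian_le_decay) auto
  finally show ?thesis by (simp add: t_def)
qed

subsection \<open>Pairing with the Calderon space\<close>

text \<open>Apply the maximum principle to a rectangle that contains \<open>z\<close> and is so high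
  that \<open>h\<close> is below \<open>e\<close> on its horizontal sides, with \<open>e\<close>
  arbitrary.\<close>

lemma strip_maximum_modulus:
  assumes cont: "continuous_on strip H" and hol: "H holomorphic_on open_strip"
    and h: "\<And>z. z \<in> strip \<Longrightarrow> cmod (H z) \<le> h (Im z)" "(h \<longlongrightarrow> 0) at_infinity"
    and B: "\<And>t. cmod (H (Complex 0 t)) \<le> B" "\<And>t. cmod (H (Complex 1 t)) \<le> B"
    and z: "z \<in> strip"
  shows "cmod (H z) \<le> B"
proof (rule field_le_epsilon)
  fix e :: real assume e: "e > 0"
  have B0: "0 \<le> B" using B(1)[of 0] norm_ge_zero order_trans by blast
  have "\<forall>\<^sub>F t in at_infinity. h t < e" using h(2) e by (intro order_tendstoD) auto
  then obtain b where b: "\<And>t. b \<le> \<bar>t\<bar> \<Longrightarrow> h t < e" by (auto simp: eventually_at_infinity)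
  define T where "T = max b \<bar>Im z\<bar>"
  define S where "S = cbox (Complex 0 (- T)) (Complex 1 T)"
  have S: "S \<subseteq> strip" "interior S \<subseteq> open_strip"
    by (auto simp: S_def strip_def open_strip_def interior_cbox in_cbox_complex_iff in_box_complex_iff)
  show "cmod (H z) \<le> B + e"
  proof (rule maximum_modulus_frontier[where S = S and f = H and \<xi> = z])
    show "H holomorphic_on interior S" using hol S(2) by (rule holomorphic_on_subset)
    show "continuous_on (closure S) H"
      using continuous_on_subset[OF cont S(1)] by (simp add: S_def)
    show "bounded S" by (simp add: S_def)
    show "z \<in> S" using z by (auto simp: S_def strip_def in_cbox_complex_iff T_def)
    fix x assume "x \<in> frontier S"
    then have x: "x \<in> S" "Re x = 0 \<or> Re x = 1 \<or> \<bar>Im x\<bar> = T"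
      by (auto simp: S_def frontier_cbox in_cbox_complex_iff in_box_complex_iff)
    from x(2) consider "x = Complex 0 (Im x)" | "x = Complex 1 (Im x)" | "\<bar>Im x\<bar> = T"
      by (metis complex.collapse)
    then show "cmod (H x) \<le> B + e"
    proof cases
      case 3
      then have "h (Im x) < e" by (intro b) (simp add: T_def)
      then show ?thesis using h(1)[of x] x(1) S(1) B0 by force
    qed (use B[of "Im x"] e in \<open>metis add_increasing2 less_imp_le\<close>)+
  qed
qed

text \<open>The duality of l1 and linf is used in both directions: on the left line \<open>F\<close>
  is bounded and \<open>b\<close> is summed, on the right line the roles are exchanged. The majorant
  \<open>c n * h (Im z)\<close> only supplies the decay for the maximum principle and does not enter
  the bound.\<close>

lemma calderon_pairing:
  assumes F: "F \<in> calderon linf l1" "calderon_norm linf l1 F \<le> R" and "finite A"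
    and hol: "\<And>n. n \<in> A \<Longrightarrow> b n holomorphic_on UNIV"
    and h: "\<And>n z. n \<in> A \<Longrightarrow> z \<in> strip \<Longrightarrow> cmod (b n z) \<le> c n * h (Im z)" "(h \<longlongrightarrow> 0) at_infinity"
    and left: "\<And>t. (\<Sum>n\<in>A. cmod (b n (Complex 0 t))) \<le> C"
    and right: "\<And>t n. n \<in> A \<Longrightarrow> cmod (b n (Complex 1 t)) \<le> C" "0 \<le> C"
    and z: "z \<in> strip"
  shows "cmod (\<Sum>n\<in>A. F z n * b n z) \<le> C * R"
proof -
  obtain K where K: "\<And>z n. cmod (F z n) \<le> K" "K \<ge> 0" using calderon_bounded[OF F(1)] by blast
  have R: "0 \<le> R" using calderon_norm_nonneg[OF F(1)] F(2) by linarith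
  show ?thesis
  proof (rule strip_maximum_modulus[OF _ _ _ _ _ _ z])
    show "continuous_on strip (\<lambda>z. \<Sum>n\<in>A. F z n * b n z)"
      by (intro continuous_intros calderon_continuous F holomorphic_on_imp_continuous_on
          holomorphic_on_subset[OF hol]) auto
    show "(\<lambda>z. \<Sum>n\<in>A. F z n * b n z) holomorphic_on open_strip"
      by (intro holomorphic_intros calderon_holomorphic F holomorphic_on_subset[OF hol]) auto
    show "cmod (\<Sum>n\<in>A. F z n * b n z) \<le> (\<Sum>n\<in>A. K * c n) * h (Im z)" if "z \<in> strip" for z
      unfolding sum_distrib_right
      by (rule sum_norm_le) (auto simp: norm_mult mult.assoc intro!: mult_mono K h that)
    show "((\<lambda>t. (\<Sum>n\<in>A. K * c n) * h t) \<longlongrightarrow> 0) at_infinity"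
      using tendsto_mult_left[OF h(2)] by fastforce
    show "cmod (\<Sum>n\<in>A. F (Complex 0 t) n * b n (Complex 0 t)) \<le> C * R" for t
    proof -
      have "cmod (\<Sum>n\<in>A. F (Complex 0 t) n * b n (Complex 0 t)) \<le> (\<Sum>n\<in>A. R * cmod (b n (Complex 0 t)))"
        using order_trans[OF calderon_norm_left[OF F(1)] F(2)]
        by (intro sum_norm_le) (auto simp: norm_mult intro!: mult_right_mono)
      also have "\<dots> \<le> C * R"
        using mult_left_mono[OF left R] by (simp add: sum_distrib_left[symmetric] mult.commute)
      finally show ?thesis .
    qed
    show "cmod (\<Sum>n\<in>A. F (Complex 1 t) n * b n (Complex 1 t)) \<le> C * R" for t
    proof -
      note F1 = calderon_norm_right[OF F(1), of t]
      have "cmod (\<Sum>n\<in>A. F (Complex 1 t) n * b n (Complex 1 t)) \<le> (\<Sum>n\<in>A. C * cmod (F (Complex 1 t) n))"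
        by (rule sum_norm_le) (auto simp: norm_mult mult.commute[of C] intro!: mult_left_mono right)
      also have "\<dots> = C * (\<Sum>n\<in>A. cmod (F (Complex 1 t) n))" by (simp add: sum_distrib_left)
      also have "\<dots> \<le> C * nrm l1 (F (Complex 1 t))"
        unfolding nrm_l1 using F1(1) \<open>finite A\<close> right(2)
        by (intro mult_left_mono sum_le_suminf) (auto simp: points_l1)
      also have "\<dots> \<le> C * R" using F1(2) F(2) right(2) by (intro mult_left_mono) auto
      finally show ?thesis .
    qed
  qed
qed

text \<open>Pair with one test function, of exponent 0 and value 1 at 1/2; 128 is the bound of
  \<open>decay\<close>.\<close>

lemma calderon_half_le:
  assumes F: "F \<in> calderon linf l1" "calderon_norm linf l1 F \<le> R"
  shows "cmod (F (1/2) n) \<le> 128 * R"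
proof -
  have k: "cmod (kernel 1 0 0 z) \<le> 1 * decay (Im z)" if "z \<in> strip" for z
    using norm_kernel_le[OF that, of 1 1 0 0] by simp
  have "cmod (\<Sum>n\<in>{n}. F (1/2) n * kernel 1 0 0 (1/2)) \<le> 128 * R"
    by (rule calderon_pairing[OF F, where b = "\<lambda>_. kernel 1 0 0" and c = "\<lambda>_. 1" and h = decay])
      (use k order_trans[OF k] decay_le decay_null half_in_open_strip open_strip_subset
        in \<open>auto intro: kernel_holomorphic\<close>)
  then show ?thesis by (simp add: kernel_half)
qed

subsection \<open>Necessity\<close>

lemma higher_deriv_sum:
  assumes "finite A" "open S" "z \<in> S" "\<And>n. n \<in> A \<Longrightarrow> f n holomorphic_on S"
  shows "(deriv ^^ k) (\<lambda>w. \<Sum>n\<in>A. f n w) z = (\<Sum>n\<in>A. (deriv ^^ k) (f n) z)"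
  using assms(1,4)
proof (induction A rule: finite_induct)
  case empty
  then show ?case by simp
next
  case (insert a A)
  have "(deriv ^^ k) (\<lambda>w. f a w + (\<Sum>n\<in>A. f n w)) z
      = (deriv ^^ k) (f a) z + (deriv ^^ k) (\<lambda>w. \<Sum>n\<in>A. f n w) z"
    by (rule higher_deriv_add[OF _ _ assms(2,3)]) (use insert in \<open>auto intro!: holomorphic_intros\<close>)
  with insert show ?case by simp
qed

lemma mult_cnj_sgn: "z * cnj (sgn z) = of_real (cmod z)"
proof -
  have "z * cnj (sgn z) = of_real (inverse (cmod z)) * (z * cnj z)"
    by (simp add: sgn_div_norm scaleR_conv_of_real)
  also have "\<dots> = of_real (inverse (cmod z) * (cmod z)\<^sup>2)"
    by (simp only: complex_norm_square of_real_mult)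
  finally show ?thesis by (cases "z = 0") (simp_all add: power2_eq_square)
qed

lemma calderon_kernel_pairing:
  assumes F: "F \<in> calderon linf l1" "calderon_norm linf l1 F \<le> R" and k: "k = 1 \<or> k = 2"
    and zero: "\<And>n. (deriv ^^ k) (\<lambda>z. F z n) (1/2) = 0" and A: "finite A"
    and \<beta>: "\<And>n. n \<in> A \<Longrightarrow> 0 < \<beta> n" "\<And>n. n \<in> A \<Longrightarrow> 1 \<le> - ln (\<beta> n)" "(\<Sum>n\<in>A. (\<beta> n)\<^sup>2) \<le> 1"
  shows "(\<Sum>n\<in>A. cmod (F (1/2) n) * \<beta> n * (- ln (\<beta> n))) \<le> 2048 * R"
proof -
  define \<Lambda> where "\<Lambda> n = - ln (\<beta> n)" for n
  define p where "p n = (if k = 1 then 1 else 1 / \<Lambda> n)" for n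
  define q where "q = (if k = 1 then 0 else - 2 :: real)"
  \<comment> \<open>The phase makes \<open>F (1/2) n * u n\<close> equal to the nonnegative number
    \<open>cmod (F (1/2) n) * \<beta> n\<close>.\<close>
  define u where "u n = cnj (sgn (F (1/2) n)) * complex_of_real (\<beta> n)" for n
  define b where "b n z = u n * kernel (p n) q (- \<Lambda> n) z" for n z
  \<comment> \<open>The derivative of order \<open>k\<close> at 1/2 of the kernel with s = -
    \<Lambda> is c \<Lambda>: q - 2 s p = 2 \<Lambda> for k = 1, and 4 s (s p - q) = - 4 \<Lambda>
    for k = 2.\<close>
  define c where "c = (if k = 1 then 2 else - 4 :: real)"
  define S where "S = (\<Sum>n\<in>A. cmod (F (1/2) n) * \<beta> n * \<Lambda> n)"
  have R: "0 \<le> R" using calderon_norm_nonneg[OF F(1)] F(2) by linarith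
  have hol: "b n holomorphic_on X" for n X
    unfolding b_def by (intro holomorphic_intros kernel_holomorphic)
  have \<Lambda>: "1 \<le> \<Lambda> n" "exp (\<Lambda> n) = 1 / \<beta> n" "exp (- \<Lambda> n) = \<beta> n" if "n \<in> A" for n
    using \<beta>(1,2)[OF that] by (auto simp: \<Lambda>_def exp_minus field_simps)
  have u: "cmod (u n) \<le> \<beta> n" if "n \<in> A" for n
    using \<beta>(1)[OF that] by (simp add: u_def norm_mult norm_sgn)
  have b: "cmod (b n z) \<le> \<beta> n * (2 * exp (- \<Lambda> n * (1 - 2 * Re z)) * decay (Im z))"
    if "n \<in> A" "z \<in> strip" for n z
    unfolding b_def norm_mult
  proof (rule mult_mono[OF u norm_kernel_le])
    show "\<bar>p n\<bar> \<le> 2" using \<Lambda>(1)[OF that(1)] by (auto simp: p_def divide_le_eq)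
  qed (use that \<beta>(1)[OF that(1)] in \<open>auto simp: q_def\<close>)
  have H: "cmod (\<Sum>n\<in>A. F z n * b n z) \<le> 256 * R" if z: "z \<in> strip" for z
  proof (rule calderon_pairing[OF F A hol _ decay_null _ _ _ z])
    show "cmod (b n z) \<le> \<beta> n * (2 * exp (\<Lambda> n)) * decay (Im z)" if "n \<in> A" "z \<in> strip" for n z
    proof -
      have "- \<Lambda> n * (1 - 2 * Re z) \<le> \<Lambda> n"
        using mult_nonneg_nonneg[of "2 * \<Lambda> n" "1 - Re z"] \<Lambda>(1)[OF that(1)] that(2)
        by (simp add: strip_def algebra_simps)
      then have "\<beta> n * (2 * exp (- \<Lambda> n * (1 - 2 * Re z)) * decay (Im z))
          \<le> \<beta> n * (2 * exp (\<Lambda> n) * decay (Im z))"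
        using \<beta>(1)[OF that(1)] by (intro mult_left_mono mult_right_mono) (auto simp: decay_nonneg)
      from order_trans[OF b[OF that] this] show ?thesis by (simp only: mult.assoc)
    qed
    \<comment> \<open>On the left line exp(- \<Lambda>) = \<beta>, so \<open>b n\<close> has size
      \<beta>^2, which is summable; on the right line exp(\<Lambda>) cancels \<beta>. The constant
      is 2 * 128, from the bound 2 for p and q and the bound of \<open>decay\<close>.\<close>
    show "(\<Sum>n\<in>A. cmod (b n (Complex 0 t))) \<le> 256" for t
    proof -
      have "cmod (b n (Complex 0 t)) \<le> 256 * (\<beta> n)\<^sup>2" if n: "n \<in> A" for n
      proof -
        have "cmod (b n (Complex 0 t)) \<le> \<beta> n * (2 * \<beta> n * decay t)"
          using b[OF n, of "Complex 0 t"] \<Lambda>(3)[OF n] by simp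
        also have "\<dots> \<le> \<beta> n * (2 * \<beta> n * 128)"
          using \<beta>(1)[OF n] by (intro mult_left_mono decay_le) auto
        finally show ?thesis by (simp add: power2_eq_square)
      qed
      then have "(\<Sum>n\<in>A. cmod (b n (Complex 0 t))) \<le> (\<Sum>n\<in>A. 256 * (\<beta> n)\<^sup>2)" by (rule sum_mono)
      also have "\<dots> \<le> 256" using \<beta>(3) by (simp flip: sum_distrib_left)
      finally show ?thesis .
    qed
    show "cmod (b n (Complex 1 t)) \<le> 256" if n: "n \<in> A" for n t
      using b[OF n, of "Complex 1 t"] \<Lambda>(2)[OF n] \<beta>(1)[OF n] decay_le[of t] by simp
  qed simp
  have ball: "ball (1/2) (1/2) \<subseteq> open_strip"
  proof
    fix z :: complex assume "z \<in> ball (1/2) (1/2)"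
    then have "\<bar>Re (1/2 - z)\<bar> < 1/2"
      using abs_Re_le_cmod[of "1/2 - z"] by (simp add: dist_norm)
    then have "- (1/2) < Re (1/2 - z) \<and> Re (1/2 - z) < 1/2" by linarith
    then show "z \<in> open_strip" by (simp add: open_strip_def)
  qed
  note Fhol = holomorphic_on_subset[OF calderon_holomorphic[OF F(1)] ball]
  have "cmod ((deriv ^^ k) (\<lambda>z. \<Sum>n\<in>A. F z n * b n z) (1/2)) \<le> fact k * (256 * R) / (1/4) ^ k"
    by (rule norm_deriv_le[where r = "1/2"])
      (use ball open_strip_subset in \<open>auto intro!: holomorphic_intros Fhol hol H simp del: mem_ball\<close>)
  also have "(deriv ^^ k) (\<lambda>z. \<Sum>n\<in>A. F z n * b n z) (1/2)
      = (\<Sum>n\<in>A. (deriv ^^ k) (\<lambda>z. F z n * b n z) (1/2))"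
    by (rule higher_deriv_sum[OF A open_ball[of "1/2" "1/2"]])
      (auto intro!: holomorphic_intros Fhol hol)
  also have "\<dots> = (\<Sum>n\<in>A. of_real (c * (cmod (F (1/2) n) * \<beta> n * \<Lambda> n)))"
  proof (rule sum.cong[OF refl])
    fix n assume n: "n \<in> A"
    have db: "(deriv ^^ j) (b n) (1/2) = u n * (deriv ^^ j) (kernel (p n) q (- \<Lambda> n)) (1/2)" for j
      unfolding b_def by (rule higher_deriv_cmult[OF kernel_holomorphic _ open_UNIV]) simp
    have leibniz: "(deriv ^^ k) (\<lambda>z. F z n * b n z) (1/2)
      = (\<Sum>i = 0..k. of_nat (k choose i) * (deriv ^^ i) (\<lambda>z. F z n) (1/2) * (deriv ^^ (k - i)) (b n) (1/2))"
      by (rule higher_deriv_mult[OF Fhol hol open_ball]) simp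
    \<comment> \<open>In the Leibniz formula the term with the derivative of \<open>F\<close> of
      order \<open>k\<close> vanishes by \<open>zero\<close>; for k = 2 the mixed term vanishes
      because \<open>b n\<close> has derivative 0 at 1/2.\<close>
    have "(deriv ^^ k) (\<lambda>z. F z n * b n z) (1/2) = F (1/2) n * (u n * of_real (c * \<Lambda> n))"
      using k
    proof
      assume "k = 1"
      then show ?thesis
        using leibniz zero[of n] db[of 1] by (simp add: deriv_kernel_half p_def q_def c_def)
    next
      assume k2: "k = 2"
      have "deriv (b n) (1/2) = 0"
        using db[of 1] \<Lambda>(1)[OF n] by (simp add: deriv_kernel_half p_def q_def k2)
      moreover have "(deriv ^^ 2) (b n) (1/2) = u n * of_real (c * \<Lambda> n)"
        using db[of 2] \<Lambda>(1)[OF n] by (simp add: deriv2_kernel_half p_def q_def c_def k2)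
      ultimately show ?thesis
        using leibniz zero[of n] by (simp add: k2 numeral_2_eq_2)
    qed
    also have "\<dots> = (F (1/2) n * cnj (sgn (F (1/2) n))) * of_real (\<beta> n * (c * \<Lambda> n))"
      by (simp add: u_def mult_ac)
    also have "F (1/2) n * cnj (sgn (F (1/2) n)) = of_real (cmod (F (1/2) n))"
      by (rule mult_cnj_sgn)
    finally show "(deriv ^^ k) (\<lambda>z. F z n * b n z) (1/2)
        = of_real (c * (cmod (F (1/2) n) * \<beta> n * \<Lambda> n))"
      by (simp add: mult_ac)
  qed
  also have "\<dots> = of_real (c * S)" by (simp add: S_def sum_distrib_left)
  finally have "\<bar>c * S\<bar> \<le> fact k * (256 * R) / (1/4) ^ k" by (simp only: norm_of_real)
  \<comment> \<open>k = 1 gives 2 S \<le> 1024 R, and k = 2 gives 4 S \<le> 8192 R.\<close>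
  with k R have "S \<le> 2048 * R"
    by (auto simp: c_def numeral_2_eq_2)
  then show ?thesis by (simp add: S_def \<Lambda>_def)
qed

text \<open>Applied to x = - ln y, this absorbs the iterated logarithm in ln(y |ln y|).\<close>

lemma ln_le_half:
  fixes x :: real
  assumes "0 < x"
  shows "ln x \<le> x / 2"
  using ln_le_minus_one[of "x/2"] ln_2_less_1 assms by (simp add: ln_div)

lemma ln_le_minus_2:
  fixes x :: real
  assumes "0 < x" "x \<le> exp (- 2)"
  shows "ln x \<le> - 2"
  using assms ln_le_cancel_iff[of x "exp (- 2)"] by simp

text \<open>Suppose the sum S exceeds 1. The weights \<beta> = y |ln y| / sqrt S have square sum 1,
  and since ln S \<ge> 0 they satisfy |ln \<beta>| \<ge> |ln y| / 2. The pairing then gives r sqrt S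
  / 2 \<le> 2048 R, contrary to r > 4096 R. The smallness exp(- 2) yields the condition 1 \<le> - ln
  \<beta>.\<close>

lemma ker_Delta_sum_le_1:
  assumes F: "F \<in> ker_Delta linf l1 k" "calderon_norm linf l1 F \<le> R" and k: "k = 1 \<or> k = 2"
    and r: "0 < R" "4096 * R < r" and small: "\<And>n. cmod (F (1/2) n) / r \<le> exp (- 2)" and A: "finite A"
  shows "(\<Sum>n\<in>A. (cmod (F (1/2) n) / r)\<^sup>2 * (ln (cmod (F (1/2) n) / r))\<^sup>2) \<le> 1"
proof (rule ccontr)
  define y where "y n = cmod (F (1/2) n) / r" for n
  define S where "S = (\<Sum>n\<in>A. (y n)\<^sup>2 * (ln (y n))\<^sup>2)"
  \<comment> \<open>The pairing needs positive weights; the discarded terms are 0.\<close>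
  define B where "B = {n\<in>A. y n \<noteq> 0}"
  define \<beta> where "\<beta> n = y n * (- ln (y n)) / sqrt S" for n
  assume "\<not> ?thesis"
  then have S1: "1 < S" by (simp add: S_def y_def)
  have r0: "0 < r" using r by linarith
  have SB: "S = (\<Sum>n\<in>B. (y n)\<^sup>2 * (ln (y n))\<^sup>2)"
    unfolding S_def by (rule sum.mono_neutral_right) (use A in \<open>auto simp: B_def\<close>)
  have y: "0 < y n" "ln (y n) \<le> - 2" if "n \<in> B" for n
  proof -
    show "0 < y n" using that r0 by (auto simp: B_def y_def)
    then show "ln (y n) \<le> - 2" using small[of n] by (intro ln_le_minus_2) (auto simp: y_def)
  qed
  have \<beta>0: "0 < \<beta> n" if "n \<in> B" for n
    using y[OF that] S1 unfolding \<beta>_def by (intro divide_pos_pos mult_pos_pos) (linarith | simp)+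
  have ln\<beta>: "- ln (y n) / 2 \<le> - ln (\<beta> n)" if "n \<in> B" for n
  proof -
    have "ln (\<beta> n) = ln (y n) + ln (- ln (y n)) - ln S / 2"
      using y[OF that] S1 unfolding \<beta>_def ln_div ln_mult by (auto simp: ln_sqrt)
    moreover have "ln (- ln (y n)) \<le> - ln (y n) / 2" using y[OF that] by (intro ln_le_half) linarith
    moreover have "0 \<le> ln S" using S1 by simp
    ultimately show ?thesis by linarith
  qed
  have "(\<Sum>n\<in>B. cmod (F (1/2) n) * \<beta> n * (- ln (\<beta> n))) \<le> 2048 * R"
  proof (rule calderon_kernel_pairing[OF _ F(2) k])
    show "F \<in> calderon linf l1" using F(1) by (simp add: ker_Delta_def)
    then show "(deriv ^^ k) (\<lambda>z. F z n) (1/2) = 0" for n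
      using Delta_coordinates[of F k] F(1) k by (auto simp: ker_Delta_def fun_eq_iff)
    show "finite B" using A by (simp add: B_def)
    show "1 \<le> - ln (\<beta> n)" if "n \<in> B" for n using y[OF that] ln\<beta>[OF that] by linarith
    show "(\<Sum>n\<in>B. (\<beta> n)\<^sup>2) \<le> 1"
      using S1 SB by (simp add: \<beta>_def power_divide power_mult_distrib flip: sum_divide_distrib)
  qed (use \<beta>0 in auto)
  moreover have "r * sqrt S / 2 \<le> (\<Sum>n\<in>B. cmod (F (1/2) n) * \<beta> n * (- ln (\<beta> n)))"
  proof -
    have "r * sqrt S / 2 = (r / (2 * sqrt S)) * S" using S1 by (simp add: field_simps)
    also have "\<dots> = (\<Sum>n\<in>B. (r / (2 * sqrt S)) * ((y n)\<^sup>2 * (ln (y n))\<^sup>2))"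
      by (subst SB) (simp add: sum_distrib_left)
    also have "\<dots> = (\<Sum>n\<in>B. cmod (F (1/2) n) * \<beta> n * (- ln (y n) / 2))"
      using r0 S1 by (intro sum.cong) (auto simp: \<beta>_def y_def power2_eq_square field_simps)
    also have "\<dots> \<le> (\<Sum>n\<in>B. cmod (F (1/2) n) * \<beta> n * (- ln (\<beta> n)))"
      using \<beta>0 ln\<beta> by (intro sum_mono mult_left_mono mult_nonneg_nonneg) (auto intro: less_imp_le)
    finally show ?thesis .
  qed
  moreover have "r * 1 \<le> r * sqrt S" using r0 S1 by (intro mult_left_mono) auto
  ultimately show False using r by linarith
qed

subsection \<open>Sufficiency\<close>

text \<open>The functions \<open>t \<mapsto> M\<^sub>n powr (2 i t)\<close> are not equicontinuous, so without a correction the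
  function built from them is not continuous into \<open>linf\<close>.  Replacing \<open>M\<close> by \<open>M/\<epsilon>\<close> in the exponential,
  where \<open>\<epsilon>\<^sub>n\<^sup>2\<close> is the tail of \<open>\<Sum>M\<^sub>n\<^sup>2\<close>, puts the values on the left line into \<open>c\<^sub>0\<close> and keeps
  \<open>\<Sum>M\<^sub>n\<^sup>2/\<epsilon>\<^sub>n\<close> finite.\<close>

lemma ker_Delta_attains:
  fixes x :: "nat \<Rightarrow> complex"
  defines "s \<equiv> \<lambda>r n. (cmod (x n) / r)\<^sup>2 * (ln (cmod (x n) / r))\<^sup>2"
  assumes k: "k = 1 \<or> k = 2" and r: "0 < r" and small: "\<And>n. cmod (x n) / r \<le> exp (- 2)"
    and s: "summable (s r)" "suminf (s r) \<le> 1"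
  shows "\<exists>F\<in>ker_Delta linf l1 k. Delta linf l1 0 F = x \<and> calderon_norm linf l1 F \<le> 512 * r"
proof -
  define y where "y n = cmod (x n) / r" for n
  define L where "L n = - ln (y n)" for n
  define M where "M n = y n * L n" for n
  define \<epsilon> where "\<epsilon> n = sqrt (\<Sum>i. s r (i + n))" for n
  define \<Lambda> where "\<Lambda> n = ln (\<epsilon> n) - ln (M n)" for n
  define u where "u n = of_real (r * M n) * sgn (x n)" for n
  \<comment> \<open>With p = 1/L and s = \<Lambda>, q = 2 \<Lambda> / L makes the first derivative q
    - 2 s p vanish, and q = \<Lambda> / L the second, 4 s (s p - q).\<close>
  define \<kappa> where "\<kappa> = (if k = 1 then 2 else 1 :: real)"
  define \<phi> where "\<phi> z n = u n * kernel (1 / L n) (\<kappa> * \<Lambda> n / L n) (\<Lambda> n) z" for z n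
  define F where "F z = (if z \<in> strip then \<phi> z else (\<lambda>n. 0))" for z
  have sM: "s r n = (M n)\<^sup>2" for n
    unfolding s_def M_def L_def y_def by (simp only: power_mult_distrib power2_minus)
  have s0: "0 \<le> s r n" for n by (simp add: sM)
  note s_shift = summable_ignore_initial_segment[OF s(1)]
  have tail: "0 \<le> (\<Sum>i. s r (i + n))" for n by (rule suminf_nonneg[OF s_shift s0])
  have \<epsilon>0: "0 \<le> \<epsilon> n" and \<epsilon>2: "(\<epsilon> n)\<^sup>2 = (\<Sum>i. s r (i + n))" for n
    by (simp_all add: \<epsilon>_def tail)
  have \<epsilon>_step: "(\<epsilon> n)\<^sup>2 = s r n + (\<epsilon> (Suc n))\<^sup>2" for n
    unfolding \<epsilon>2 using suminf_split_head[OF s_shift[of n]] by simp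
  have \<epsilon>_Suc: "\<epsilon> (Suc n) \<le> \<epsilon> n" for n
    by (rule power2_le_imp_le[OF _ \<epsilon>0]) (use \<epsilon>_step[of n] s0[of n] in linarith)
  have \<epsilon>_le_1: "\<epsilon> n \<le> 1" for n
  proof -
    have "\<epsilon> n \<le> \<epsilon> 0" by (rule lift_Suc_antimono_le[of \<epsilon>, OF \<epsilon>_Suc]) simp
    also have "\<dots> \<le> 1" using s(2) by (simp add: \<epsilon>_def)
    finally show ?thesis .
  qed
  have M_le: "M n \<le> \<epsilon> n" for n
    by (rule power2_le_imp_le[OF _ \<epsilon>0]) (use \<epsilon>_step[of n] sM[of n] in simp)
  have \<epsilon>_null: "\<epsilon> \<longlonglongrightarrow> 0"
  proof -
    have "(\<lambda>n. \<Sum>i. s r (i + n)) \<longlonglongrightarrow> 0" using suminf_exist_split2[OF s(1)] by simp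
    from tendsto_real_sqrt[OF this] show ?thesis by (simp add: \<epsilon>_def[abs_def])
  qed
  \<comment> \<open>Where \<open>x n = 0\<close> the factor \<open>u n\<close> is 0 and nothing else
    matters. Elsewhere \<Lambda> = L + ln \<epsilon> - ln L lies between 0 and L, which keeps the
    coefficient q of the kernel at most 2.\<close>
  have pos: "2 \<le> L n" "0 < M n" "0 < \<epsilon> n" "0 \<le> \<Lambda> n" "\<Lambda> n \<le> L n" "y n = M n / L n"
      "exp (\<Lambda> n) = \<epsilon> n / M n" "exp (- \<Lambda> n) = M n / \<epsilon> n"
    if "x n \<noteq> 0" for n
  proof -
    have y: "0 < y n" using that r by (simp add: y_def)
    then show L: "2 \<le> L n" using ln_le_minus_2[of "y n"] small[of n] by (simp add: L_def y_def)
    with y show M: "0 < M n" by (simp add: M_def)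
    with M_le[of n] show \<epsilon>: "0 < \<epsilon> n" by linarith
    have lny: "ln (y n) = - L n" by (simp add: L_def)
    have "ln (M n) \<le> ln (\<epsilon> n)" using M M_le[of n] by simp
    then show "0 \<le> \<Lambda> n" by (simp add: \<Lambda>_def)
    have "ln (M n) = - L n + ln (L n)"
      using y L lny by (simp add: M_def ln_mult)
    moreover have "ln (\<epsilon> n) \<le> 0" using \<epsilon> \<epsilon>_le_1[of n] by simp
    moreover have "0 \<le> ln (L n)" using L by simp
    ultimately show "\<Lambda> n \<le> L n" by (simp add: \<Lambda>_def)
    show "y n = M n / L n" using L by (simp add: M_def)
    show "exp (\<Lambda> n) = \<epsilon> n / M n" "exp (- \<Lambda> n) = M n / \<epsilon> n"
      using M \<epsilon> by (simp_all add: \<Lambda>_def exp_diff)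
  qed
  have zero: "\<phi> z n = 0" if "x n = 0" for z n by (simp add: \<phi>_def u_def that)
  have bound: "cmod (\<phi> z n) \<le> r * M n * (2 * exp (\<Lambda> n * (1 - 2 * Re z)) * decay (Im z))"
    if z: "z \<in> strip" and x: "x n \<noteq> 0" for z n
    unfolding \<phi>_def norm_mult
  proof (rule mult_mono[OF _ norm_kernel_le[OF z]])
    note p = pos[OF x]
    show "cmod (u n) \<le> r * M n" using r p(2) x by (simp add: u_def norm_mult norm_sgn)
    show "0 \<le> r * M n" using r p(2) by simp
    show "\<bar>1 / L n\<bar> \<le> 2" using p(1) by (simp add: divide_le_eq)
    have "\<kappa> * \<Lambda> n \<le> 2 * L n" using p(1,4,5) by (auto simp: \<kappa>_def)
    then show "\<bar>\<kappa> * \<Lambda> n / L n\<bar> \<le> 2" using p(1,4) by (simp add: \<kappa>_def divide_le_eq)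
  qed simp
  \<comment> \<open>\<open>s r n\<close> is the difference of consecutive values of \<epsilon>^2.
    Factoring it and dividing by \<epsilon> leaves a telescoping majorant with sum 2
    \<open>\<epsilon> 0\<close>; where \<epsilon> is 0, the quotient is 0 by convention.\<close>
  have s_le: "s r n / \<epsilon> n \<le> 2 * (\<epsilon> n - \<epsilon> (Suc n))" for n
  proof (cases "\<epsilon> n = 0")
    case True
    then show ?thesis using \<epsilon>_Suc[of n] \<epsilon>0[of "Suc n"] by simp
  next
    case False
    have "s r n = (\<epsilon> n - \<epsilon> (Suc n)) * (\<epsilon> n + \<epsilon> (Suc n))"
      using \<epsilon>_step[of n] by (simp add: power2_eq_square algebra_simps)
    also have "\<dots> \<le> (\<epsilon> n - \<epsilon> (Suc n)) * (2 * \<epsilon> n)"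
      using \<epsilon>_Suc[of n] by (intro mult_left_mono) auto
    finally show ?thesis using False \<epsilon>0[of n] by (simp add: divide_le_eq mult_ac)
  qed
  have tele: "(\<lambda>n. 2 * (\<epsilon> n - \<epsilon> (Suc n))) sums (2 * \<epsilon> 0)"
    using sums_mult[OF telescope_sums'[OF \<epsilon>_null], of 2] by simp
  have s\<epsilon>0: "0 \<le> s r n / \<epsilon> n" for n using s0 \<epsilon>0 by simp
  have s\<epsilon>: "summable (\<lambda>n. s r n / \<epsilon> n)"
    by (rule summable_comparison_test'[OF sums_summable[OF tele], of 0])
      (simp only: real_norm_def abs_of_nonneg[OF s\<epsilon>0] s_le)
  have s\<epsilon>_le: "(\<Sum>n. s r n / \<epsilon> n) \<le> 2"
    using suminf_le[OF s_le s\<epsilon> sums_summable[OF tele]] sums_unique[OF tele] \<epsilon>_le_1[of 0] by simp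
  have hol: "(\<lambda>z. \<phi> z n) holomorphic_on UNIV" for n
    unfolding \<phi>_def by (intro holomorphic_intros kernel_holomorphic)
  have left: "cmod (\<phi> z n) \<le> 2 * r * \<epsilon> n * decay (Im z)" if z: "z \<in> strip" for z n
  proof (cases "x n = 0")
    case False
    have "\<Lambda> n * (1 - 2 * Re z) \<le> \<Lambda> n * 1"
      using pos(4)[OF False] z by (intro mult_left_mono) (auto simp: strip_def)
    then have "cmod (\<phi> z n) \<le> r * M n * (2 * exp (\<Lambda> n) * decay (Im z))"
      using r pos(2)[OF False]
      by (intro order_trans[OF bound[OF z False]] mult_left_mono mult_right_mono) (auto simp: decay_nonneg)
    also have "\<dots> = 2 * r * \<epsilon> n * decay (Im z)"
      using pos(2,7)[OF False] by simp
    finally show ?thesis .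
  qed (use r \<epsilon>0 decay_nonneg in \<open>simp add: zero\<close>)
  have right: "cmod (\<phi> (Complex 1 t) n) \<le> 2 * r * (s r n / \<epsilon> n) * decay t" for t n
  proof (cases "x n = 0")
    case False
    have "cmod (\<phi> (Complex 1 t) n) \<le> r * M n * (2 * exp (- \<Lambda> n) * decay t)"
      using bound[OF _ False, of "Complex 1 t"] by simp
    also have "\<dots> = 2 * r * (s r n / \<epsilon> n) * decay t"
      unfolding pos(8)[OF False] sM by (simp add: power2_eq_square)
    finally show ?thesis .
  next
    case True
    have "0 \<le> 2 * r * (s r n / \<epsilon> n) * decay t"
      using r by (intro mult_nonneg_nonneg s\<epsilon>0 decay_nonneg) auto
    then show ?thesis by (simp only: zero[OF True] norm_zero)
  qed
  \<comment> \<open>Both majorants share the bound 4 r, so \<open>calderonI\<close> with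
    \<open>decay\<close> at most 128 gives the constant 512 = 4 * 128.\<close>
  have e_le: "2 * r * \<epsilon> n \<le> 4 * r" for n
    using mult_left_mono[OF \<epsilon>_le_1, of "2 * r" n] r by simp
  have e_null: "(\<lambda>n. 2 * r * \<epsilon> n) \<longlonglongrightarrow> 0"
    using tendsto_mult_left[OF \<epsilon>_null, of "2 * r"] by simp
  have a_le: "(\<Sum>n. 2 * r * (s r n / \<epsilon> n)) \<le> 4 * r"
    using suminf_mult[OF s\<epsilon>, of "2 * r"] mult_left_mono[OF s\<epsilon>_le, of "2 * r"] r by simp
  have nonneg: "0 \<le> 2 * r * \<epsilon> n" "0 \<le> 2 * r * (s r n / \<epsilon> n)" for n
    using r by (auto intro!: mult_nonneg_nonneg \<epsilon>0 s\<epsilon>0 simp del: times_divide_eq_right)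
  note calderon = calderonI[OF hol decay_nonneg decay_le decay_null left e_null nonneg(1) e_le
      right summable_mult[OF s\<epsilon>] nonneg(2) a_le, folded F_def[abs_def]]
  have "\<forall>\<^sub>F z in nhds (1/2). F z n = \<phi> z n" for n
    using eventually_nhds_in_open[OF open_open_strip half_in_open_strip]
    by eventually_elim (use open_strip_subset in \<open>auto simp: F_def\<close>)
  then have "(deriv ^^ j) (\<lambda>z. F z n) (1/2) = (deriv ^^ j) (\<lambda>z. \<phi> z n) (1/2)" for j n
    by (intro higher_deriv_cong_ev) auto
  moreover have "(deriv ^^ j) (\<lambda>z. \<phi> z n) (1/2)
      = u n * (deriv ^^ j) (kernel (1 / L n) (\<kappa> * \<Lambda> n / L n) (\<Lambda> n)) (1/2)" for j n
    unfolding \<phi>_def by (rule higher_deriv_cmult[OF kernel_holomorphic _ open_UNIV]) simp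
  ultimately have D: "(deriv ^^ j) (\<lambda>z. F z n) (1/2)
      = u n * (deriv ^^ j) (kernel (1 / L n) (\<kappa> * \<Lambda> n / L n) (\<Lambda> n)) (1/2)" for j n
    by simp
  have "F \<in> ker_Delta linf l1 k"
    using k
  proof
    assume "k = 1"
    then show ?thesis
      using calderon(1) D[of 1] Delta_coordinates[OF calderon(1), of 1]
      by (simp add: ker_Delta_def deriv_kernel_half \<kappa>_def)
  next
    assume "k = 2"
    then show ?thesis
      using calderon(1) D[of 2] Delta_coordinates[OF calderon(1), of 2]
      by (simp add: ker_Delta_def deriv2_kernel_half \<kappa>_def)
  qed
  moreover have "Delta linf l1 0 F = x"
  proof
    fix n
    have "Delta linf l1 0 F n = u n * of_real (1 / L n)"
      using Delta_coordinates[OF calderon(1), of 0] D[of 0] by (simp add: kernel_half)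
    also have "\<dots> = x n"
    proof (cases "x n = 0")
      case False
      have "u n * of_real (1 / L n) = of_real (r * (M n / L n)) * sgn (x n)" by (simp add: u_def)
      also have "r * (M n / L n) = cmod (x n)" unfolding pos(6)[OF False, symmetric] y_def using r by simp
      finally show ?thesis by (simp add: sgn_div_norm scaleR_conv_of_real False)
    qed (simp add: u_def)
    finally show "Delta linf l1 0 F n = x n" .
  qed
  ultimately show ?thesis using calderon(2) by auto
qed

subsection \<open>The Orlicz space\<close>

lemma orlicz_function_nonneg: "orlicz_function f \<Longrightarrow> 0 \<le> t \<Longrightarrow> 0 \<le> f t"
  unfolding orlicz_function_def by (metis atLeast_iff mono_onD order_refl)

text \<open>Convexity on the segment from 0 to \<open>t\<close>, together with f 0 = 0.\<close>

lemma orlicz_function_divide_le: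
  assumes f: "orlicz_function f" and t: "0 \<le> t" and c: "1 \<le> c"
  shows "f (t / c) \<le> f t / c"
proof -
  have "f ((1 - 1/c) *\<^sub>R 0 + (1/c) *\<^sub>R t) \<le> (1 - 1/c) * f 0 + (1/c) * f t"
    by (rule convex_onD[of "{0..}"]) (use f t c in \<open>auto simp: orlicz_function_def\<close>)
  then show ?thesis using f by (simp add: orlicz_function_def)
qed

lemma nrm_orlicz_space_le:
  assumes "r > 0" "summable (\<lambda>n. f (cmod (x n) / r))" "(\<Sum>n. f (cmod (x n) / r)) \<le> 1"
  shows "nrm (orlicz_space f) x \<le> r"
  unfolding orlicz_space_def seq_space.select_convs
  by (rule cInf_lower) (use assms in \<open>auto intro!: bdd_belowI[of _ 0]\<close>)

text \<open>Membership only asks for a finite sum. Enlarging \<open>r\<close> by the factor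
  \<open>c\<close> divides the sum by at least \<open>c\<close>, so the Luxemburg norm is an infimum
  over a nonempty set.\<close>

lemma orlicz_space_unit_sum_exists:
  assumes f: "orlicz_function f" and x: "x \<in> points (orlicz_space f)"
  obtains r where "r > 0" "summable (\<lambda>n. f (cmod (x n) / r))" "(\<Sum>n. f (cmod (x n) / r)) \<le> 1"
proof -
  obtain r where r: "r > 0" and s: "summable (\<lambda>n. f (cmod (x n) / r))"
    using x by (auto simp: orlicz_space_def)
  define c where "c = max 1 (\<Sum>n. f (cmod (x n) / r))"
  have c: "1 \<le> c" by (simp add: c_def)
  have le: "f (cmod (x n) / (r * c)) \<le> f (cmod (x n) / r) / c" for n
    using orlicz_function_divide_le[OF f _ c, of "cmod (x n) / r"] r by simp
  have s': "summable (\<lambda>n. f (cmod (x n) / r) / c)" using s by (rule summable_divide)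
  have s'': "summable (\<lambda>n. f (cmod (x n) / (r * c)))"
    by (rule summable_comparison_test'[OF s', of 0])
      (use le r c orlicz_function_nonneg[OF f] in simp)
  have "(\<Sum>n. f (cmod (x n) / (r * c))) \<le> (\<Sum>n. f (cmod (x n) / r)) / c"
    using suminf_le[OF le s'' s'] suminf_divide[OF s, of c] by simp
  also have "\<dots> \<le> 1" using c by (simp add: c_def)
  finally show thesis using s'' r c by (intro that[of "r * c"]) auto
qed

text \<open>The summand 128 / \<delta> pushes all moduli into the range where the formula for
  \<open>f\<close> holds; 4097 meets the strict bound 4096 of \<open>ker_Delta_sum_le_1\<close>.
  Working with R strictly above the norm keeps R positive even for norm 0, and density of the reals
  recovers the norm itself.\<close>

lemma ker_Delta_orlicz:
  assumes f: "orlicz_function f" and near: "\<And>t. 0 \<le> t \<Longrightarrow> t \<le> \<delta> \<Longrightarrow> f t = t\<^sup>2 * (ln t)\<^sup>2"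
    and \<delta>: "0 < \<delta>" "\<delta> \<le> exp (- 2)" and k: "k = 1 \<or> k = 2"
    and F: "F \<in> ker_Delta linf l1 k"
  shows "F (1/2) \<in> points (orlicz_space f)"
    and "nrm (orlicz_space f) (F (1/2)) \<le> (128 / \<delta> + 4097) * calderon_norm linf l1 F"
proof -
  define c where "c = 128 / \<delta> + 4097"
  have c: "4096 < c" "0 < c" "128 \<le> \<delta> * c"
    using \<delta>(1) divide_pos_pos[of 128 \<delta>] by (auto simp: c_def field_simps simp del: divide_pos_pos)
  have cal: "F \<in> calderon linf l1" using F by (simp add: ker_Delta_def)
  have main: "summable (\<lambda>n. f (cmod (F (1/2) n) / (c * R)))"
      "(\<Sum>n. f (cmod (F (1/2) n) / (c * R))) \<le> 1" "0 < R"
    if R: "calderon_norm linf l1 F < R" for R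
  proof -
    show R0: "0 < R" using R calderon_norm_nonneg[OF cal] by linarith
    have small: "cmod (F (1/2) n) / (c * R) \<le> \<delta>" for n
    proof -
      have "cmod (F (1/2) n) \<le> 128 * R" using calderon_half_le[OF cal] R by simp
      also have "\<dots> \<le> \<delta> * (c * R)" using mult_right_mono[OF c(3), of R] R0 by (simp add: mult.assoc)
      finally show ?thesis using c R0 by (simp add: divide_le_eq)
    qed
    have eq: "f (cmod (F (1/2) n) / (c * R))
        = (cmod (F (1/2) n) / (c * R))\<^sup>2 * (ln (cmod (F (1/2) n) / (c * R)))\<^sup>2" for n
      using c R0 small by (intro near) auto
    have fin: "(\<Sum>n<N. f (cmod (F (1/2) n) / (c * R))) \<le> 1" for N
      unfolding eq
      by (rule ker_Delta_sum_le_1[OF F _ k R0]) (use R c R0 order_trans[OF small \<delta>(2)] in auto)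
    show s: "summable (\<lambda>n. f (cmod (F (1/2) n) / (c * R)))"
      using fin c R0 by (intro summableI_nonneg_bounded orlicz_function_nonneg[OF f]) auto
    show "(\<Sum>n. f (cmod (F (1/2) n) / (c * R))) \<le> 1" using s fin by (rule suminf_le_const)
  qed
  show "F (1/2) \<in> points (orlicz_space f)"
    using main[of "calderon_norm linf l1 F + 1"] c(2) unfolding orlicz_space_def
    by (auto intro!: exI[of _ "c * (calderon_norm linf l1 F + 1)"])
  have "nrm (orlicz_space f) (F (1/2)) / c \<le> calderon_norm linf l1 F"
  proof (rule dense_ge)
    fix R assume R: "calderon_norm linf l1 F < R"
    have "nrm (orlicz_space f) (F (1/2)) \<le> c * R"
      using main[OF R] c(2) by (intro nrm_orlicz_space_le) auto
    then show "nrm (orlicz_space f) (F (1/2)) / c \<le> R" using c(2) by (simp add: divide_le_eq mult.commute)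
  qed
  then show "nrm (orlicz_space f) (F (1/2)) \<le> (128 / \<delta> + 4097) * calderon_norm linf l1 F"
    using c(2) by (simp add: divide_le_eq mult.commute flip: c_def)
qed

text \<open>The formula for \<open>f\<close> is available only near 0. Each inclusion first rescales
  the sequence into that range, at the cost of a constant that depends on \<open>f\<close>
  alone.\<close>

lemma Delta_image_eq_orlicz_space:
  assumes f: "orlicz_function f" and near: "\<forall>\<^sub>F t in at_right 0. f t = t\<^sup>2 * (ln t)\<^sup>2"
    and k: "k = 1 \<or> k = 2"
  shows "equal_spaces
    (image_space (Delta linf l1 0) (ker_Delta linf l1 k) (calderon_norm linf l1)) (orlicz_space f)"
proof -
  let ?I = "image_space (Delta linf l1 0) (ker_Delta linf l1 k) (calderon_norm linf l1)"
  let ?A = "\<lambda>x. {calderon_norm linf l1 F |F. F \<in> ker_Delta linf l1 k \<and> Delta linf l1 0 F = x}"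
  obtain d where d: "d > 0" "\<And>t. 0 < t \<Longrightarrow> t < d \<Longrightarrow> f t = t\<^sup>2 * (ln t)\<^sup>2"
    using near unfolding eventually_at_right_field by auto
  define \<delta> where "\<delta> = min (d / 2) (exp (- 2))"
  have \<delta>: "0 < \<delta>" "\<delta> \<le> exp (- 2)" "\<delta> < d" using d(1) by (auto simp: \<delta>_def min_less_iff_disj)
  have f0: "f 0 = 0" using f by (simp add: orlicz_function_def)
  have f\<delta>: "f t = t\<^sup>2 * (ln t)\<^sup>2" if "0 \<le> t" "t \<le> \<delta>" for t
    using d(2)[of t] that \<delta>(3) f0 by (cases "t = 0") auto
  have "\<forall>\<^sub>F t in at_top. 1 < f t"
    using f unfolding orlicz_function_def filterlim_at_top_dense by blast
  then obtain T where T: "\<And>t. T \<le> t \<Longrightarrow> 1 < f t" by (auto simp: eventually_at_top_linorder)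
  \<comment> \<open>A sum at most 1 forces f(|x|/r) \<le> 1, hence |x|/r < T; dividing by
    \<open>c\<close> brings this down to \<delta>.\<close>
  define c where "c = max 1 (T / \<delta>)"
  have c: "1 \<le> c" "T \<le> \<delta> * c" using \<delta>(1) by (auto simp: c_def max_def field_simps)
  \<comment> \<open>Every \<open>r\<close> admissible in the Luxemburg norm produces a preimage of
    norm at most 512 c r.\<close>
  have inI: "x \<in> points ?I \<and> nrm ?I x \<le> 512 * c * r"
    if r: "r > 0" and s: "summable (\<lambda>n. f (cmod (x n) / r))" "(\<Sum>n. f (cmod (x n) / r)) \<le> 1" for x r
  proof -
    have nonneg: "0 \<le> f (cmod (x n) / a)" if "0 < a" for n a
      using that by (intro orlicz_function_nonneg[OF f]) simp
    have small: "cmod (x n) / (c * r) \<le> \<delta>" for n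
    proof -
      have "f (cmod (x n) / r) \<le> 1"
        using sum_le_suminf[OF s(1), of "{n}"] s(2) nonneg[OF r] by fastforce
      then have "cmod (x n) / r < T" using T by (meson not_le)
      then have "cmod (x n) / r \<le> \<delta> * c" using c(2) by linarith
      then show ?thesis using c(1) r by (simp add: divide_le_eq mult_ac)
    qed
    let ?s = "\<lambda>n. (cmod (x n) / (c * r))\<^sup>2 * (ln (cmod (x n) / (c * r)))\<^sup>2"
    have eq: "f (cmod (x n) / (c * r)) = ?s n" for n
      using c r small by (intro f\<delta>) auto
    have le: "?s n \<le> f (cmod (x n) / r)" for n
    proof -
      have "f (cmod (x n) / r / c) \<le> f (cmod (x n) / r) / c"
        using r by (intro orlicz_function_divide_le[OF f _ c(1)]) simp
      also have "\<dots> \<le> f (cmod (x n) / r)"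
        using nonneg[OF r, of n] c(1) by (simp add: divide_le_eq mult_le_cancel_left1)
      finally show ?thesis using eq[of n] by (simp add: mult.commute)
    qed
    have ss: "summable ?s"
      by (rule summable_comparison_test'[OF s(1), of 0]) (use le in simp)
    have "suminf ?s \<le> 1" using suminf_le[OF le ss s(1)] s(2) by linarith
    then obtain F where F: "F \<in> ker_Delta linf l1 k" "Delta linf l1 0 F = x"
        "calderon_norm linf l1 F \<le> 512 * (c * r)"
      using ker_Delta_attains[OF k, of "c * r" x] c(1) r order_trans[OF small \<delta>(2)] ss by auto
    have "Inf (?A x) \<le> calderon_norm linf l1 F"
      by (rule cInf_lower)
        (use F in \<open>auto intro!: bdd_belowI[of _ 0] calderon_norm_nonneg simp: ker_Delta_def\<close>)
    with F show ?thesis by (auto simp: image_space_def)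
  qed
  have Delta0: "Delta linf l1 0 F = F (1/2)" for F by (simp add: Delta_def)
  have out: "x \<in> points (orlicz_space f) \<and> nrm (orlicz_space f) x \<le> (128 / \<delta> + 4097) * nrm ?I x"
    if x: "x \<in> points ?I" for x
  proof -
    have C: "0 < 128 / \<delta> + 4097" using \<delta>(1) by (simp add: add_pos_pos)
    note l = ker_Delta_orlicz[OF f f\<delta> \<delta>(1,2) k]
    have ne: "?A x \<noteq> {}" using x by (auto simp: image_space_def)
    have "nrm (orlicz_space f) x / (128 / \<delta> + 4097) \<le> Inf (?A x)"
      by (rule cInf_greatest[OF ne]) (use l(2) C in \<open>auto simp: Delta0 divide_le_eq mult.commute\<close>)
    moreover have "x \<in> points (orlicz_space f)"
      using x l(1) by (auto simp: image_space_def Delta0)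
    ultimately show ?thesis using C by (simp add: image_space_def divide_le_eq mult.commute)
  qed
  have upper: "x \<in> points ?I \<and> nrm ?I x \<le> 512 * c * nrm (orlicz_space f) x"
    if x: "x \<in> points (orlicz_space f)" for x
  proof -
    let ?R = "{r. r > 0 \<and> summable (\<lambda>n. f (cmod (x n) / r)) \<and> (\<Sum>n. f (cmod (x n) / r)) \<le> 1}"
    obtain r where "r > 0" "summable (\<lambda>n. f (cmod (x n) / r))" "(\<Sum>n. f (cmod (x n) / r)) \<le> 1"
      by (rule orlicz_space_unit_sum_exists[OF f x])
    then have r: "r \<in> ?R" by simp
    then have "nrm ?I x / (512 * c) \<le> Inf ?R"
      using inI[of _ x] c(1) by (intro cInf_greatest) (blast, simp add: divide_le_eq mult_ac)
    moreover have "x \<in> points ?I" using inI[of r x] r by auto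
    ultimately show ?thesis using c(1) by (simp add: orlicz_space_def divide_le_eq mult_ac)
  qed
  have C: "0 < 128 / \<delta> + 4097" using \<delta>(1) by (simp add: add_pos_pos)
  have points: "points ?I = points (orlicz_space f)" using out upper by blast
  moreover have "1 / (128 / \<delta> + 4097) * nrm (orlicz_space f) x \<le> nrm ?I x
      \<and> nrm ?I x \<le> 512 * c * nrm (orlicz_space f) x" if "x \<in> points ?I" for x
    using out[OF that] upper[of x] C by (simp add: divide_le_eq mult.commute)
  moreover have "0 < 1 / (128 / \<delta> + 4097)" "0 < 512 * c" using C c(1) by auto
  ultimately show ?thesis unfolding equal_spaces_def by blast
qed

lemma equal_spaces_common:
  assumes "equal_spaces X Z" "equal_spaces Y Z"
  shows "equal_spaces X Y"
proof -
  obtain a A where a: "a > 0" "A > 0"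
    "\<And>x. x \<in> points X \<Longrightarrow> a * nrm Z x \<le> nrm X x \<and> nrm X x \<le> A * nrm Z x"
    using assms(1) unfolding equal_spaces_def by blast
  obtain b B where b: "b > 0" "B > 0"
    "\<And>x. x \<in> points Y \<Longrightarrow> b * nrm Z x \<le> nrm Y x \<and> nrm Y x \<le> B * nrm Z x"
    using assms(2) unfolding equal_spaces_def by blast
  have p: "points X = points Y" using assms by (simp add: equal_spaces_def)
  have "a / B * nrm Y x \<le> nrm X x \<and> nrm X x \<le> A / b * nrm Y x" if x: "x \<in> points X" for x
  proof
    have "a / B * nrm Y x \<le> a / B * (B * nrm Z x)"
      using a b x p by (intro mult_left_mono) auto
    with a(3)[OF x] b(2) show "a / B * nrm Y x \<le> nrm X x" by simp
    have "A / b * (b * nrm Z x) \<le> A / b * nrm Y x"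
      using a b x p by (intro mult_left_mono) auto
    with a(3)[OF x] b(1) show "nrm X x \<le> A / b * nrm Y x" by simp
  qed
  moreover have "a / B > 0" "A / b > 0" using a b by auto
  ultimately show ?thesis using p unfolding equal_spaces_def by blast
qed

theorem proposition5p5:
  fixes f :: "real \<Rightarrow> real"
  assumes "orlicz_function f"
    and "\<forall>\<^sub>F t in at_right 0. f t = t\<^sup>2 * (ln t)\<^sup>2"
  shows "equal_spaces
           (image_space (Delta linf l1 0) (ker_Delta linf l1 2) (calderon_norm linf l1))
           (image_space (Delta linf l1 0) (ker_Delta linf l1 1) (calderon_norm linf l1)) \<and>
         equal_spaces
           (image_space (Delta linf l1 0) (ker_Delta linf l1 1) (calderon_norm linf l1))
           (orlicz_space f)"
proof -
  note image = Delta_image_eq_orlicz_space[OF assms]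
  show ?thesis
    using equal_spaces_common[OF image[of 2] image[of 1]] image[of 1] by blast
qed

end
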